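(* Let $G=\langle a,b,c,t \mid tat^{-1}=a,\ tbt^{-1}=ba,\ tct^{-1}=ca^2\rangle$ be Gersten's free-by-cyclic group. Then $G$ has no faithful representation into $GL(4,\mathbb{C})$. Consequently $m(G)>4$; that is, for every $d\le 4$ and every field $\mathbb{F}$ (of any characteristic) there is no injective homomorphism $G\to GL(d,\mathbb{F})$.
   Context: For a finitely generated group $G$ and $p$ equal to $0$ or a prime, $m_p(G)$ denotes the minimum $d$ such that there exists a field $\mathbb{F}$ of characteristic $p$ and an injective homomorphism $G\to GL(d,\mathbb{F})$ (with $m_p(G)=\infty$ if none exists), and $m(G)=\min_p m_p(G)$. The group $G$ above is the semidirect product $F_3\rtimes_\alpha\mathbb{Z}$ where $F_3$ is free on $a,b,c$ and $\alpha(a)=a$, $\alpha(b)=ba$, $\alpha(c)=ca^2$. *)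

theory Defs
  imports "HOL-Algebra.Group" "Jordan_Normal_Form.Matrix"
begin

text \<open>Free group F_3 on a, b, c as freely reduced words. A letter is a generator
  together with a flag; flag True means the inverse of the generator.\<close>

datatype gen = GA | GB | GC

type_synonym letter = "gen \<times> bool"

definition inv_letter :: "letter \<Rightarrow> letter" where
  "inv_letter x = (fst x, \<not> snd x)"

fun reduced :: "letter list \<Rightarrow> bool" where
  "reduced [] = True"
| "reduced [x] = True"
| "reduced (x # y # ys) = (y \<noteq> inv_letter x \<and> reduced (y # ys))"

definition red_cons :: "letter \<Rightarrow> letter list \<Rightarrow> letter list" where
  "red_cons x ws = (case ws of [] \<Rightarrow> [x]
                    | y # ys \<Rightarrow> (if y = inv_letter x then ys else x # ws))"

definition normalize :: "letter list \<Rightarrow> letter list" where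
  "normalize w = foldr red_cons w []"

definition fmult :: "letter list \<Rightarrow> letter list \<Rightarrow> letter list" where
  "fmult u v = foldr red_cons u (normalize v)"

definition apow :: "int \<Rightarrow> letter list" where
  "apow k = (if 0 \<le> k then replicate (nat k) (GA, False) else replicate (nat (- k)) (GA, True))"

text \<open>The automorphism alpha: a -> a, b -> ba, c -> ca^2, and its integer powers:
  alpha^m(a) = a, alpha^m(b) = b a^m, alpha^m(c) = c a^(2m).\<close>
fun alpha_letter :: "int \<Rightarrow> letter \<Rightarrow> letter list" where
  "alpha_letter m (GA, s) = [(GA, s)]"
| "alpha_letter m (GB, False) = (GB, False) # apow m"
| "alpha_letter m (GB, True) = apow (- m) @ [(GB, True)]"
| "alpha_letter m (GC, False) = (GC, False) # apow (2 * m)"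
| "alpha_letter m (GC, True) = apow (- 2 * m) @ [(GC, True)]"

definition alpha_pow :: "int \<Rightarrow> letter list \<Rightarrow> letter list" where
  "alpha_pow m w = normalize (concat (map (alpha_letter m) w))"

text \<open>Elements of G are pairs (w, n) standing for w t^n, with t x t^-1 = alpha(x).
  Hence (u, m)(v, n) = (u alpha^m(v), m + n).\<close>
definition gersten_group :: "(letter list \<times> int) monoid" where
  "gersten_group = \<lparr>
     carrier = {(w, n). reduced w},
     mult = (\<lambda>(u, m) (v, n). (fmult u (alpha_pow m v), m + n)),
     one = ([], 0) \<rparr>"

definition GL :: "nat \<Rightarrow> ('f::field) mat monoid" where
  "GL d = \<lparr> carrier = {A. A \<in> carrier_mat d d \<and> invertible_mat A},
            mult = (*),
            one = 1\<^sub>m d \<rparr>"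

end

theory Submission
  imports Defs "HOL-Analysis.Determinants" "HOL-Algebra.Algebraic_Closure_Type"
    "HOL-Library.Function_Algebras"
begin

text \<open>
  The relations say that the commuting elements \<open>t\<close>, \<open>a t\<close>, \<open>a\<^sup>2 t\<close> are conjugate. Let \<open>(\<alpha>\<^sub>i, \<tau>\<^sub>i)\<close> be the
  joint eigenvalues of \<open>a\<close> and \<open>t\<close> over the algebraic closure. The multisets of the \<open>\<tau>\<^sub>i\<close>, the
  \<open>\<alpha>\<^sub>i \<tau>\<^sub>i\<close> and the \<open>\<alpha>\<^sub>i\<^sup>2 \<tau>\<^sub>i\<close> agree, so for every additive character \<open>\<phi>\<close> of the multiplicative group with
  values in the rationals the second difference of \<open>\<Sum> \<phi>(\<tau>\<^sub>i)\<^sup>2\<close> gives \<open>\<Sum> \<phi>(\<alpha>\<^sub>i)\<^sup>2 = 0\<close>; hence every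
  \<open>\<alpha>\<^sub>i\<close> is a root of unity and some power of \<open>a\<close> is unipotent. Since \<open>a\<^sup>m, b, c, t\<^sup>m\<close> satisfy the
  same relations, \<open>a\<close> itself may be taken unipotent. In characteristic 2 it is then torsion.

  Otherwise put \<open>y = b a b\<inverse>\<close>, which commutes with \<open>t\<close>, restrict to a generalised eigenspace of \<open>t\<close>
  with eigenvalue \<open>s\<close> (of dimension at most 4), and let \<open>N = t/s - 1\<close>. If \<open>N\<^sup>2 \<noteq> 0\<close>, kernels and images of
  powers of \<open>N\<close> form a complete flag that is stable under the centraliser of \<open>N\<close>, so \<open>a\<close> and \<open>y\<close> act by
  unitriangular matrices of size at most 4, and such groups are metabelian. If \<open>N\<^sup>2 = 0\<close>, conjugacy of
  \<open>t\<close>, \<open>a t\<close>, \<open>a\<^sup>2 t\<close> and the bound on the dimension force \<open>(a - 1) (y - 1) = 0 = (y - 1) (a - 1)\<close>. In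
  both cases the commutators \<open>[a, y]\<close> and \<open>[a\<inverse>, y]\<close> commute, which is false in the free group.
\<close>

(* HOL-Algebra reserves the identifier X for polynomial variables. *)
no_notation vec_index (infixl "$" 100) and var ("X\<index>")
hide_const (open) Matrix.mat

subsection \<open>The ring of linear endomorphisms\<close>

text \<open>As a type of their own the linear maps form an instance of \<open>ring_1\<close>, so
  that powers and ring simplification apply to them directly.\<close>

typedef (overloaded) ('a, 'n) endo =
  "{f :: 'a::field ^ 'n::finite \<Rightarrow> 'a ^ 'n. Vector_Spaces.linear (*s) (*s) f}"
  morphisms ap Endo
  by (rule exI[of _ "\<lambda>v. v"]) (simp add: vec.linear_ident)

setup_lifting type_definition_endo

notation ap (infixr "\<star>" 75)

instantiation endo :: (field, finite) ring_1
begin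
lift_definition zero_endo :: "('a, 'b) endo" is "\<lambda>v. 0"
  by (simp add: vec.linear_zero)
lift_definition one_endo :: "('a, 'b) endo" is "\<lambda>v. v"
  by (simp add: vec.linear_ident)
lift_definition plus_endo :: "('a, 'b) endo \<Rightarrow> ('a, 'b) endo \<Rightarrow> ('a, 'b) endo"
  is "\<lambda>f g v. f v + g v"
  by (simp add: vec.linear_compose_add)
lift_definition minus_endo :: "('a, 'b) endo \<Rightarrow> ('a, 'b) endo \<Rightarrow> ('a, 'b) endo"
  is "\<lambda>f g v. f v - g v"
  by (simp add: vec.linear_compose_sub)
lift_definition uminus_endo :: "('a, 'b) endo \<Rightarrow> ('a, 'b) endo" is "\<lambda>f v. - f v"
  by (simp add: vec.linear_compose_neg)
lift_definition times_endo :: "('a, 'b) endo \<Rightarrow> ('a, 'b) endo \<Rightarrow> ('a, 'b) endo"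
  is "\<lambda>f g v. f (g v)"
  using Vector_Spaces.linear_compose by (force simp: o_def)
instance
proof
  show "(0::('a, 'b) endo) \<noteq> 1"
  proof transfer
    have "(\<chi> i. 1) \<noteq> (0 :: 'a ^ 'b)" by (simp add: vec_eq_iff)
    then show "(\<lambda>v::'a ^ 'b. 0) \<noteq> (\<lambda>v. v)" by metis
  qed
qed (transfer; auto simp: algebra_simps fun_eq_iff vec.linear_add dest: vec.linear_add)+
end

lift_definition scal :: "'a::field \<Rightarrow> ('a, 'n::finite) endo" is "\<lambda>c v. c *s v"
  by (simp add: vec.linear_scale_self)

lemma ap_simps [simp]:
  "(0 :: ('a::field, 'n::finite) endo) \<star> v = 0" "(1 :: ('a, 'n) endo) \<star> v = v"
  "(X * Y) \<star> v = X \<star> Y \<star> v" "(X + Y) \<star> v = X \<star> v + Y \<star> v"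
  "(X - Y) \<star> v = X \<star> v - Y \<star> v" "(- X) \<star> v = - (X \<star> v)"
  "scal c \<star> v = c *s v"
  by (transfer; simp)+

lemma linear_ap: "Vector_Spaces.linear (*s) (*s) (ap X)"
  using ap[of X] by simp

lemma ap_lin [simp]:
  "X \<star> (v + w) = X \<star> v + X \<star> w" "X \<star> (v - w) = X \<star> v - X \<star> w"
  "X \<star> (- v) = - (X \<star> v)" "X \<star> 0 = 0" "X \<star> (c *s v) = c *s (X \<star> v)"
  by (simp_all add: vec.linear_add[OF linear_ap] vec.linear_diff[OF linear_ap]
      vec.linear_neg[OF linear_ap] vec.linear_0[OF linear_ap] vec.linear_scale[OF linear_ap])

lemma endo_eqI: "(\<And>v. X \<star> v = Y \<star> v) \<Longrightarrow> X = Y"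
  by (transfer, auto)

lemma scal_commute: "scal c * X = X * scal c"
  by (rule endo_eqI) simp

lemma commute_diff_scal: "X * T = T * X \<Longrightarrow> X * (T - scal r) = (T - scal r) * X"
  by (simp add: algebra_simps scal_commute)

lemma commute_power: "(X::'r::monoid_mult) * Y = Y * X \<Longrightarrow> X * Y ^ k = Y ^ k * X"
  by (induction k) (simp_all, metis mult.assoc)

subsection \<open>Evaluation of polynomials\<close>

text \<open>Horner's scheme, with the coefficients acting as scalar endomorphisms.\<close>

definition peval :: "('a::field, 'n::finite) endo \<Rightarrow> 'a poly \<Rightarrow> ('a, 'n) endo" where
  "peval T p = fold_coeffs (\<lambda>c X. scal c + T * X) p 0"

lemma scal_0 [simp]: "scal 0 = 0"
  by (rule endo_eqI) simp

lemma peval_0 [simp]: "peval T 0 = 0"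
  by (simp add: peval_def)

lemma peval_pCons [simp]: "peval T (pCons c p) = scal c + T * peval T p"
  by (cases "c = 0 \<and> p = 0") (auto simp: peval_def)

lemma peval_add: "peval T (p + q) = peval T p + peval T q"
proof (induction p arbitrary: q)
  case IH: (pCons a p)
  show ?case
  proof (cases q)
    case (pCons b q')
    have "scal (a + b) = (scal a + scal b :: ('a, 'b) endo)"
      by (rule endo_eqI) (simp add: vector_sadd_rdistrib)
    then show ?thesis by (simp add: pCons IH.IH algebra_simps)
  qed
qed simp

lemma peval_smult: "peval T (smult c p) = scal c * peval T p"
proof (induction p)
  case (pCons a p)
  then show ?case
    by (simp, intro endo_eqI) (simp add: vector_add_ldistrib vector_smult_assoc)
qed simp

lemma peval_linear_factor: "peval T ([:- r, 1:] * p) = (T - scal r) * peval T p"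
proof -
  have "[:- r, 1:] * p = smult (- r) p + pCons 0 p" by simp
  then show ?thesis
    by (simp only: peval_add peval_smult) (auto intro!: endo_eqI)
qed

lemma peval_commute:
  assumes "S * T = T * S" shows "S * peval T p = peval T p * S"
proof (induction p)
  case (pCons c p)
  have "S * (T * peval T p) = T * peval T p * S"
    by (metis assms mult.assoc pCons.IH)
  then show ?case by (simp add: algebra_simps scal_commute)
qed simp

lemma peval_invariant:
  assumes "vec.subspace U" "\<And>u. u \<in> U \<Longrightarrow> T \<star> u \<in> U" "u \<in> U"
  shows "peval T p \<star> u \<in> U"
  by (induction p) (use assms in \<open>auto simp: vec.subspace_0 vec.subspace_add vec.subspace_scale\<close>)

lemma peval_monom: "peval T (monom 1 i) = T ^ i"
proof (induction i)
  case 0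
  show ?case by (simp only: monom_0 peval_pCons) (rule endo_eqI, simp)
qed (simp only: monom_Suc peval_pCons power_Suc, simp)

text \<open>The bound on the coefficients of \<open>p\<close> keeps \<open>monom 1 k - p\<close>
  nonzero; this difference serves as an annihilating polynomial.\<close>

lemma span_powers_peval:
  assumes "w \<in> vec.span ((\<lambda>i. (T ^ i) \<star> v) ` {..<k})"
  shows "\<exists>p. (\<forall>i\<ge>k. coeff p i = 0) \<and> w = peval T p \<star> v"
  using assms
proof (induction rule: vec.span_induct_alt)
  case base
  show ?case by (rule exI[of _ 0]) simp
next
  case (step c x y)
  then obtain i p where i: "i < k" "x = (T ^ i) \<star> v" and
    p: "\<forall>i\<ge>k. coeff p i = 0" "y = peval T p \<star> v" by auto
  show ?case
    by (rule exI[of _ "smult c (monom 1 i) + p"]) (use i p in \<open>simp add: peval_add peval_smult peval_monom\<close>)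
qed

text \<open>In finite dimension the iterates of \<open>v\<close> under \<open>T\<close> cannot stay
  independent, and an iterate that depends on its predecessors gives a monic polynomial.\<close>

lemma annihilating_poly: "\<exists>p. p \<noteq> 0 \<and> peval T p \<star> v = 0"
proof -
  define S where "S k = (\<lambda>i. (T ^ i) \<star> v) ` {..<k}" for k
  have S_Suc: "S (Suc k) = insert ((T ^ k) \<star> v) (S k)" for k
    by (simp add: S_def lessThan_Suc)
  have "\<exists>k. (T ^ k) \<star> v \<in> vec.span (S k)"
  proof (rule ccontr)
    assume *: "\<not> ?thesis"
    have ind: "vec.independent (S k) \<and> finite (S k) \<and> card (S k) = k" for k
    proof (induction k)
      case 0
      show ?case by (simp add: S_def vec.independent_empty)
    next
      case (Suc k)
      have ns: "(T ^ k) \<star> v \<notin> vec.span (S k)" using * by blast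
      then have "(T ^ k) \<star> v \<notin> S k" by (meson vec.span_base)
      then show ?case using Suc ns unfolding S_Suc
        by (simp add: vec.independent_insert)
    qed
    have "card (S (Suc (vec.dim (UNIV :: ('a ^ 'b) set)))) \<le> vec.dim (UNIV :: ('a ^ 'b) set)"
      by (rule vec.independent_card_le_dim) (simp_all add: ind)
    with ind[of "Suc (vec.dim (UNIV :: ('a ^ 'b) set))"] show False by simp
  qed
  then obtain k where "(T ^ k) \<star> v \<in> vec.span (S k)" by blast
  then obtain p where p: "\<forall>i\<ge>k. coeff p i = 0" "(T ^ k) \<star> v = peval T p \<star> v"
    using span_powers_peval unfolding S_def by blast
  let ?q = "smult (-1) p + monom 1 k"
  have "coeff ?q k = 1" using p by simp
  then have "?q \<noteq> 0" by (metis coeff_0 zero_neq_one)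
  moreover have "peval T ?q \<star> v = 0"
    unfolding peval_add peval_smult peval_monom by (simp add: p)
  ultimately show ?thesis by blast
qed

text \<open>Linear factors are split off \<open>p\<close> one at a time. As long as the remaining
  factor still sends \<open>v\<close> into \<open>U\<close> the descent goes on; it cannot reach a
  constant because \<open>v\<close> is outside \<open>U\<close>, and where it stops an eigenvector
  modulo \<open>U\<close> appears.\<close>

lemma eigenvector_mod_aux:
  fixes T :: "('a::alg_closed_field, 'n::finite) endo"
  assumes "vec.subspace U" "v \<notin> U" "p \<noteq> 0" "peval T p \<star> v \<in> U"
  shows "\<exists>q r. peval T q \<star> v \<notin> U \<and> (T - scal r) \<star> peval T q \<star> v \<in> U"
  using assms(3,4)
proof (induction "degree p" arbitrary: p)
  case 0
  then obtain c where "p = [:c:]" "c \<noteq> 0" by (metis degree_eq_zeroE pCons_0_0)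
  with 0 have "c *s v \<in> U" by simp
  then have "inverse c *s (c *s v) \<in> U" by (rule vec.subspace_scale[OF assms(1)])
  with \<open>c \<noteq> 0\<close> assms(2) show ?case by simp
next
  case (Suc n)
  then obtain r where "poly p r = 0" by (metis alg_closed_imp_poly_has_root zero_less_Suc)
  then obtain q where q: "p = [:- r, 1:] * q" by (metis dvdE poly_eq_0_iff_dvd)
  show ?case
  proof (cases "peval T q \<star> v \<in> U")
    case True
    have "q \<noteq> 0" using q Suc.prems by auto
    then have "degree p = Suc (degree q)" unfolding q by (subst degree_mult_eq) auto
    with Suc \<open>q \<noteq> 0\<close> True show ?thesis by auto
  next
    case False
    moreover have "(T - scal r) \<star> peval T q \<star> v \<in> U"
      using Suc.prems(2) unfolding q peval_linear_factor ap_simps(3) .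
    ultimately show ?thesis by blast
  qed
qed

lemma eigenvector_mod:
  fixes T :: "('a::alg_closed_field, 'n::finite) endo"
  assumes "vec.subspace U" "v \<notin> U"
  shows "\<exists>q r. peval T q \<star> v \<notin> U \<and> (T - scal r) \<star> peval T q \<star> v \<in> U"
proof -
  obtain p where "p \<noteq> 0" "peval T p \<star> v = 0" using annihilating_poly by blast
  then show ?thesis
    using eigenvector_mod_aux[OF assms, of p T] vec.subspace_0[OF assms(1)] by simp
qed

text \<open>An eigenvector of \<open>S\<close> modulo \<open>U\<close> is found first and then moved
  by a polynomial in \<open>T\<close> to one of \<open>T\<close>. This polynomial commutes with
  \<open>S - scal r\<close> and preserves \<open>U\<close>, so the first property survives.\<close>

lemma common_eigenvector_mod:
  fixes S T :: "('a::alg_closed_field, 'n::finite) endo"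
  assumes "vec.subspace U" "U \<noteq> UNIV" "S * T = T * S"
    and "\<And>u. u \<in> U \<Longrightarrow> T \<star> u \<in> U"
  shows "\<exists>v r s. v \<notin> U \<and> (S - scal r) \<star> v \<in> U \<and> (T - scal s) \<star> v \<in> U"
proof -
  obtain v where "v \<notin> U" using assms(2) by blast
  then obtain q r where w: "peval S q \<star> v \<notin> U" "(S - scal r) \<star> peval S q \<star> v \<in> U"
    using eigenvector_mod[OF assms(1)] by blast
  obtain p s where u: "peval T p \<star> peval S q \<star> v \<notin> U" "(T - scal s) \<star> peval T p \<star> peval S q \<star> v \<in> U"
    using eigenvector_mod[OF assms(1) w(1)] by blast
  have "(S - scal r) * T = T * (S - scal r)"
    by (rule commute_diff_scal[symmetric]) (rule assms(3)[symmetric])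
  then have "(S - scal r) * peval T p = peval T p * (S - scal r)" by (rule peval_commute)
  then have "(S - scal r) \<star> peval T p \<star> peval S q \<star> v = peval T p \<star> (S - scal r) \<star> peval S q \<star> v"
    by (metis ap_simps(3))
  then have "(S - scal r) \<star> peval T p \<star> peval S q \<star> v \<in> U"
    using peval_invariant[OF assms(1,4) w(2)] by simp
  with u show ?thesis by blast
qed

subsection \<open>Generalised eigenspaces\<close>

definition gen :: "('a::field, 'n::finite) endo \<Rightarrow> 'a \<Rightarrow> ('a ^ 'n) set" where
  "gen T r = {v. \<exists>k. ((T - scal r) ^ k) \<star> v = 0}"

lemma power_kills_mono:
  assumes "(X ^ k) \<star> v = 0" "k \<le> l" shows "(X ^ l) \<star> v = 0"
proof -
  have "X ^ l = X ^ (l - k) * X ^ k" using assms(2) by (simp flip: power_add)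
  then show ?thesis using assms(1) by simp
qed

lemma subspace_gen: "vec.subspace (gen T r)"
proof (rule vec.subspaceI)
  fix v w assume "v \<in> gen T r" "w \<in> gen T r"
  then obtain k l where k: "((T - scal r) ^ k) \<star> v = 0" and l: "((T - scal r) ^ l) \<star> w = 0"
    by (auto simp: gen_def)
  have "((T - scal r) ^ (max k l)) \<star> (v + w) = 0"
    using power_kills_mono[OF k max.cobounded1] power_kills_mono[OF l max.cobounded2] by simp
  then show "v + w \<in> gen T r" unfolding gen_def by blast
qed (auto simp: gen_def)

lemma gen_invariant:
  assumes "X * T = T * X" "v \<in> gen T r" shows "X \<star> v \<in> gen T r"
proof -
  note commute_diff_scal[OF assms(1), of r]
  then have "((T - scal r) ^ k) \<star> X \<star> v = X \<star> ((T - scal r) ^ k) \<star> v" for k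
    by (metis ap_simps(3) commute_power)
  moreover obtain k where "((T - scal r) ^ k) \<star> v = 0" using assms(2) by (auto simp: gen_def)
  ultimately have "((T - scal r) ^ k) \<star> X \<star> v = 0" by simp
  then show ?thesis unfolding gen_def by blast
qed

text \<open>On \<open>gen T s\<close> the operator \<open>T - scal r\<close> is the nonzero scalar
  \<open>s - r\<close> plus the locally nilpotent \<open>T - scal s\<close>, hence invertible. The
  induction is the geometric series: a solution \<open>v\<close> for
  \<open>(T - scal s) \<star> w\<close> turns \<open>w - v\<close>, divided by \<open>s - r\<close>,
  into a solution for \<open>w\<close>.\<close>

lemma gen_solve:
  assumes "r \<noteq> s" "((T - scal s) ^ k) \<star> w = 0"
  shows "\<exists>v\<in>gen T s. (T - scal r) \<star> v = w"
  using assms(2)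
proof (induction k arbitrary: w)
  case 0
  then show ?case using vec.subspace_0[OF subspace_gen] by force
next
  case (Suc k)
  have "((T - scal s) ^ k) \<star> (T - scal s) \<star> w = 0"
    using Suc.prems by (metis ap_simps(3) power_Suc2)
  then obtain v where v: "v \<in> gen T s" "(T - scal r) \<star> v = (T - scal s) \<star> w"
    using Suc.IH by blast
  have w: "w \<in> gen T s" unfolding gen_def using Suc.prems by blast
  let ?u = "inverse (s - r) *s (w - v)"
  have "(T - scal r) \<star> ?u = inverse (s - r) *s ((T - scal r) \<star> w - (T - scal r) \<star> v)"
    by (simp only: ap_lin)
  also have "\<dots> = inverse (s - r) *s ((s - r) *s w)"
    unfolding v by (simp add: vector_sub_rdistrib algebra_simps)
  also have "\<dots> = w" using assms(1) by simp
  finally show ?case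
    using vec.subspace_scale[OF subspace_gen vec.subspace_diff[OF subspace_gen w v(1)]] by blast
qed

text \<open>Components with eigenvalue other than \<open>r\<close> have preimages under
  \<open>T - scal r\<close> by \<open>gen_solve\<close>. So some \<open>u\<close> in the span makes
  \<open>(T - scal r) \<star> (v - u)\<close> lie in \<open>gen T r\<close>, and then
  \<open>v - u\<close> lies there too.\<close>

lemma span_gen_step:
  assumes "(T - scal r) \<star> v \<in> vec.span (\<Union>s. gen T s)"
  shows "v \<in> vec.span (\<Union>s. gen T s)"
proof -
  let ?G = "vec.span (\<Union>s. gen T s)"
  have "\<exists>u\<in>?G. w - (T - scal r) \<star> u \<in> gen T r" if "w \<in> ?G" for w
    using that
  proof (induction rule: vec.span_induct_alt)
    case base
    show ?case by (rule bexI[of _ 0]) (auto simp: vec.span_zero vec.subspace_0[OF subspace_gen])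
  next
    case (step c x y)
    then obtain s u where x: "x \<in> gen T s" and u: "u \<in> ?G" "y - (T - scal r) \<star> u \<in> gen T r" by blast
    have "\<exists>z\<in>?G. x - (T - scal r) \<star> z \<in> gen T r"
    proof (cases "s = r")
      case True
      then show ?thesis using x by (intro bexI[of _ 0]) (auto simp: vec.span_zero)
    next
      case False
      obtain k where "((T - scal s) ^ k) \<star> x = 0" using x by (auto simp: gen_def)
      from gen_solve[OF not_sym[OF False] this]
      obtain z where z: "z \<in> gen T s" "(T - scal r) \<star> z = x" by blast
      then have "z \<in> ?G" by (intro vec.span_base) blast
      moreover have "x - (T - scal r) \<star> z \<in> gen T r"
        unfolding z(2) by (simp add: vec.subspace_0[OF subspace_gen])
      ultimately show ?thesis by blast
    qed
    then obtain z where z: "z \<in> ?G" "x - (T - scal r) \<star> z \<in> gen T r" by blast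
    have "c *s (x - (T - scal r) \<star> z) + (y - (T - scal r) \<star> u) \<in> gen T r"
      using z u by (intro vec.subspace_add[OF subspace_gen] vec.subspace_scale[OF subspace_gen])
    moreover have "c *s (x - (T - scal r) \<star> z) + (y - (T - scal r) \<star> u)
        = (c *s x + y) - (T - scal r) \<star> (c *s z + u)"
      by (simp only: ap_lin vector_ssub_ldistrib diff_diff_eq2 add_diff_eq diff_add_eq) (simp only: diff_diff_eq ac_simps)
    ultimately have "(c *s x + y) - (T - scal r) \<star> (c *s z + u) \<in> gen T r" by (simp only:)
    moreover have "c *s z + u \<in> ?G" using z u by (intro vec.span_add vec.span_scale)
    ultimately show ?case by (rule bexI)
  qed
  then obtain u where u: "u \<in> ?G" "(T - scal r) \<star> v - (T - scal r) \<star> u \<in> gen T r"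
    using assms by blast
  then have "(T - scal r) \<star> (v - u) \<in> gen T r" by (simp only: ap_lin)
  then obtain k where "((T - scal r) ^ k) \<star> ((T - scal r) \<star> (v - u)) = 0"
    unfolding gen_def by blast
  then have "((T - scal r) ^ Suc k) \<star> (v - u) = 0" by (simp only: power_Suc2 ap_simps(3))
  then have "v - u \<in> gen T r" unfolding gen_def by blast
  then have "v - u \<in> ?G" by (intro vec.span_base) blast
  from vec.span_add[OF this u(1)] show ?thesis by simp
qed

lemma span_gen_aux:
  fixes T :: "('a::alg_closed_field, 'n::finite) endo"
  assumes "p \<noteq> 0" "peval T p \<star> v = 0"
  shows "v \<in> vec.span (\<Union>s. gen T s)"
  using assms
proof (induction "degree p" arbitrary: p v)
  case 0
  then obtain c where "p = [:c:]" "c \<noteq> 0" by (metis degree_eq_zeroE pCons_0_0)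
  with 0 show ?case by (auto simp: vec.span_zero)
next
  case (Suc n)
  then obtain r where "poly p r = 0" by (metis alg_closed_imp_poly_has_root zero_less_Suc)
  then obtain q where q: "p = [:- r, 1:] * q" by (metis dvdE poly_eq_0_iff_dvd)
  have "q \<noteq> 0" using q Suc.prems by auto
  then have d: "degree p = Suc (degree q)" unfolding q by (subst degree_mult_eq) auto
  have "(T - scal r) * peval T q = peval T q * (T - scal r)"
    by (rule peval_commute) (simp add: algebra_simps scal_commute)
  then have "peval T q \<star> (T - scal r) \<star> v = 0"
    using Suc.prems(2) unfolding q by (metis ap_simps(3) peval_linear_factor)
  then have "(T - scal r) \<star> v \<in> vec.span (\<Union>s. gen T s)"
    using Suc.hyps(1)[of q] Suc.hyps(2) d \<open>q \<noteq> 0\<close> by auto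
  then show ?case by (rule span_gen_step)
qed

text \<open>Primary decomposition, obtained by peeling the linear factors off an annihilating
  polynomial of \<open>v\<close>.\<close>

lemma span_gen:
  fixes T :: "('a::alg_closed_field, 'n::finite) endo"
  shows "v \<in> vec.span (\<Union>s. gen T s)"
  using annihilating_poly span_gen_aux by blast

text \<open>Reduces an identity of operators to a single generalised eigenspace.\<close>

lemma endo_eq_on_gen:
  fixes T :: "('a::alg_closed_field, 'n::finite) endo"
  assumes "\<And>s v. v \<in> gen T s \<Longrightarrow> X \<star> v = Y \<star> v"
  shows "X = Y"
proof (rule endo_eqI)
  fix v show "X \<star> v = Y \<star> v"
    using span_gen[of v T]
    by (induction rule: vec.span_induct_alt) (auto simp: assms)
qed

text \<open>Instead of a binomial expansion: one factor \<open>X + D\<close> sends \<open>v\<close>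
  to \<open>X \<star> v + D \<star> v\<close>, and each summand has one of its two exponents
  lowered.\<close>

lemma sum_nilpotent_kills:
  assumes "X * D = D * X" "(X ^ k) \<star> v = 0" "(D ^ l) \<star> v = 0"
  shows "\<exists>m. ((X + D) ^ m) \<star> v = 0"
  using assms(2,3)
proof (induction "k + l" arbitrary: k l v rule: less_induct)
  case less
  show ?case
  proof (cases "k = 0 \<or> l = 0")
    case True
    then have "v = 0" using less.prems by auto
    then show ?thesis by auto
  next
    case False
    then obtain k' l' where kl: "k = Suc k'" "l = Suc l'" by (metis not0_implies_Suc)
    have "X ^ k * D = D * X ^ k" "X * D ^ l = D ^ l * X"
      using commute_power assms(1) by metis+
    then have "(X ^ k) \<star> D \<star> v = 0" "(D ^ l) \<star> X \<star> v = 0"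
      using less.prems by (metis ap_simps(3) ap_lin(4))+
    moreover have "(X ^ k') \<star> X \<star> v = 0" "(D ^ l') \<star> D \<star> v = 0"
      using less.prems kl by (metis ap_simps(3) power_Suc2)+
    ultimately obtain m n where m: "((X + D) ^ m) \<star> X \<star> v = 0" and n: "((X + D) ^ n) \<star> D \<star> v = 0"
      using less.hyps[of k' l "X \<star> v"] less.hyps[of k l' "D \<star> v"] kl by auto
    have "((X + D) ^ max m n) \<star> (X \<star> v + D \<star> v) = 0"
      using power_kills_mono[OF m max.cobounded1] power_kills_mono[OF n max.cobounded2] by simp
    then have "((X + D) ^ Suc (max m n)) \<star> v = 0" by (simp only: power_Suc2 ap_simps)
    then show ?thesis by blast
  qed
qed

text \<open>\<open>a * T - scal r\<close> is the sum of \<open>T - scal r\<close> and the nilpotent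
  \<open>(a - 1) * T\<close>, and the two commute. With the inverse of \<open>a\<close> the reverse
  inclusion follows as well.\<close>

lemma gen_unipotent_subset:
  assumes "a * T = T * a" "(a - 1) ^ k = 0"
  shows "gen T r \<subseteq> gen (a * T) r"
proof
  fix v assume "v \<in> gen T r"
  then obtain l where l: "((T - scal r) ^ l) \<star> v = 0" by (auto simp: gen_def)
  have c: "(a - 1) * T = T * (a - 1)" by (simp add: algebra_simps assms(1))
  have "((a - 1) * T) ^ j = (a - 1) ^ j * T ^ j" for j
  proof (induction j)
    case (Suc j)
    have "T * (a - 1) ^ j = (a - 1) ^ j * T" by (rule commute_power) (rule c[symmetric])
    then have "(a - 1) * (T * (a - 1) ^ j) * T ^ j = (a - 1) * ((a - 1) ^ j * T) * T ^ j" by simp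
    then show ?case unfolding power_Suc Suc by (simp only: mult.assoc)
  qed simp
  then have "((a - 1) * T) ^ k = 0" using assms(2) by simp
  moreover have "T * ((a - 1) * T) = (a - 1) * T * T" unfolding c mult.assoc ..
  then have "(T - scal r) * ((a - 1) * T) = ((a - 1) * T) * (T - scal r)"
    by (rule commute_diff_scal[symmetric, OF sym])
  ultimately obtain m where "(((T - scal r) + (a - 1) * T) ^ m) \<star> v = 0"
    using sum_nilpotent_kills[OF _ l, of "(a - 1) * T" k] by auto
  moreover have "(T - scal r) + (a - 1) * T = a * T - scal r" by (simp add: algebra_simps)
  ultimately show "v \<in> gen (a * T) r" by (auto simp: gen_def)
qed

subsection \<open>Operators commuting with a nilpotent operator\<close>

lemma subspace_ap_image: "vec.subspace U \<Longrightarrow> vec.subspace (ap X ` U)"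
  by (rule vec.linear_subspace_image[OF linear_ap])

lemma subspace_ker: "vec.subspace U \<Longrightarrow> vec.subspace {u \<in> U. X \<star> u = 0}"
  by (auto simp: vec.subspace_def)

text \<open>\<open>X\<close> is injective and maps \<open>U\<close> into itself, so by dimension it
  maps \<open>U\<close> onto itself.\<close>

lemma inverse_invariant:
  fixes X Y :: "('a::field, 'n::finite) endo"
  assumes "Y * X = 1" "vec.subspace U" "\<And>u. u \<in> U \<Longrightarrow> X \<star> u \<in> U" "u \<in> U"
  shows "Y \<star> u \<in> U"
proof -
  have YX: "Y \<star> X \<star> w = w" for w using assms(1) by (metis ap_simps(2,3))
  then have "inj_on (ap X) (vec.span U)" by (metis inj_on_inverseI)
  then have "vec.dim (ap X ` U) = vec.dim U" by (rule vec.dim_image_eq[OF linear_ap])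
  moreover have "ap X ` U \<subseteq> U" using assms(3) by blast
  ultimately have "ap X ` U = U"
    using vec.subspace_dim_equal subspace_ap_image assms(2) by (metis order_refl)
  then show ?thesis using assms(4) YX by (metis imageE)
qed

text \<open>A basis \<open>B\<close> of the kernel is extended to a basis \<open>C\<close> of
  \<open>W\<close>; the span \<open>D\<close> of the added vectors is a complement of the kernel and
  is mapped isomorphically onto the image.\<close>

lemma rank_nullity:
  fixes X :: "('a::field, 'n::finite) endo"
  assumes "vec.subspace W"
  shows "vec.dim (ap X ` W) + vec.dim {w \<in> W. X \<star> w = 0} = vec.dim W"
proof -
  let ?K = "{w \<in> W. X \<star> w = 0}"
  obtain B where B: "B \<subseteq> ?K" "vec.independent B" "?K \<subseteq> vec.span B" "card B = vec.dim ?K"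
    using vec.basis_exists[of ?K] by blast
  have "B \<subseteq> W" using B(1) by blast
  then obtain C where C: "B \<subseteq> C" "C \<subseteq> W" "vec.independent C" "W \<subseteq> vec.span C"
    using vec.maximal_independent_subset_extend B(2) by metis
  define D where "D = vec.span (C - B)"
  have fC: "finite C" using C(3) vec.finiteI_independent by blast
  have dW: "vec.dim W = card C" using C vec.basis_card_eq_dim by metis
  have "vec.independent (C - B)" using C(3) vec.independent_mono by blast
  then have dD: "vec.dim D = card C - card B"
    unfolding D_def using C(1) fC by (simp add: vec.dim_eq_card_independent card_Diff_subset finite_subset)
  have KW: "vec.subspace ?K" by (rule subspace_ker[OF assms])
  have DW: "D \<subseteq> W" unfolding D_def using C(2) assms by (intro vec.span_minimal) auto
  have sK: "vec.span B = ?K" using B KW by (metis vec.span_minimal subset_antisym)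
  have "{x + y |x y. x \<in> ?K \<and> y \<in> D} = vec.span (B \<union> (C - B))"
    unfolding vec.span_Un sK D_def by auto
  also have "\<dots> = W" using C assms by (simp add: Un_absorb1 vec.span_minimal subset_antisym)
  finally have sum: "{x + y |x y. x \<in> ?K \<and> y \<in> D} = W" .
  have "card B \<le> card C" using C(1) fC card_mono by blast
  then have "vec.dim (?K \<inter> D) = 0"
    using vec.dim_sums_Int[OF KW, of D] unfolding sum dW dD B(4)[symmetric]
    by (simp add: D_def)
  then have int: "?K \<inter> D \<subseteq> {0}" by simp
  have "inj_on (ap X) D"
    unfolding vec.linear_inj_on_iff_eq_0[OF linear_ap vec.subspace_span[of "C - B", folded D_def]]
    using int DW by blast
  then have "vec.dim (ap X ` D) = vec.dim D"
    using vec.dim_image_eq[OF linear_ap, of X D] unfolding D_def vec.span_span by blast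
  moreover have "ap X ` W = ap X ` D"
  proof
    show "ap X ` W \<subseteq> ap X ` D"
    proof
      fix z assume "z \<in> ap X ` W"
      then obtain w where w: "w \<in> W" "z = X \<star> w" by blast
      then have "w \<in> {x + y |x y. x \<in> ?K \<and> y \<in> D}" by (simp only: sum)
      then obtain x y where "w = x + y" "x \<in> ?K" "y \<in> D" by blast
      then show "z \<in> ap X ` D" using w(2) by auto
    qed
  qed (use DW in blast)
  ultimately show ?thesis using dD dW B(4) \<open>card B \<le> card C\<close> by simp
qed

text \<open>The quotient of \<open>B\<close> by \<open>A\<close> has dimension at most 1, so
  \<open>X - 1\<close> acts on it by a scalar \<open>c\<close>. Nilpotency gives
  \<open>c ^ k = 0\<close>.\<close>

lemma unipotent_step:
  fixes X :: "('a::field, 'n::finite) endo"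
  assumes "vec.subspace A" "vec.subspace B" "A \<subseteq> B" "vec.dim B \<le> Suc (vec.dim A)"
    and "\<And>v. v \<in> A \<Longrightarrow> X \<star> v \<in> A" "\<And>v. v \<in> B \<Longrightarrow> X \<star> v \<in> B"
    and "(X - 1) ^ k = 0" "v \<in> B"
  shows "(X - 1) \<star> v \<in> A"
proof (cases "v \<in> A")
  case True
  from vec.subspace_diff[OF assms(1) assms(5)[OF True] True] show ?thesis by simp
next
  case False
  define M where "M = X - 1"
  have MA: "M \<star> w \<in> A" if "w \<in> A" for w using vec.subspace_diff[OF assms(1) assms(5)[OF that] that] by (simp add: M_def)
  have MB: "M \<star> w \<in> B" if "w \<in> B" for w using vec.subspace_diff[OF assms(2) assms(6)[OF that] that] by (simp add: M_def)
  have spA: "vec.span A = A" by (rule vec.span_eq_iff[THEN iffD2, OF assms(1)])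
  have "B = vec.span (insert v A)"
  proof (rule vec.subspace_dim_equal[symmetric])
    have "v \<notin> vec.span A" using False unfolding spA .
    then have "vec.dim (insert v A) = Suc (vec.dim A)" by (simp add: vec.dim_insert)
    then show "vec.dim B \<le> vec.dim (vec.span (insert v A))" using assms(4) by simp
    show "vec.span (insert v A) \<subseteq> B" using assms(2,3,8) by (intro vec.span_minimal) auto
  qed (simp_all add: assms(2))
  then have "M \<star> v \<in> vec.span (insert v A)" using MB assms(8) by blast
  then obtain c where "M \<star> v - c *s v \<in> vec.span A" by (auto simp: vec.span_insert)
  then have c: "M \<star> v - c *s v \<in> A" unfolding spA .
  have "(M ^ j) \<star> v - c ^ j *s v \<in> A" for j
  proof (induction j)
    case 0
    show ?case using assms(1) vec.subspace_0 by simp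
  next
    case (Suc j)
    have "M \<star> ((M ^ j) \<star> v - c ^ j *s v) + c ^ j *s (M \<star> v - c *s v) \<in> A"
      by (intro vec.subspace_add[OF assms(1)] vec.subspace_scale[OF assms(1)] MA Suc c)
    then show ?case by (simp add: vector_ssub_ldistrib vector_smult_assoc mult.commute)
  qed
  from this[of k] have "- (c ^ k *s v) \<in> A" using assms(7) by (simp add: M_def)
  from vec.subspace_neg[OF assms(1) this] have cv: "c ^ k *s v \<in> A" by simp
  have "c ^ k = 0"
  proof (rule ccontr)
    assume "c ^ k \<noteq> 0"
    with vec.subspace_scale[OF assms(1) cv, of "inverse (c ^ k)"] False
    show False by (simp add: vector_smult_assoc)
  qed
  then show ?thesis using c by (simp flip: M_def)
qed

section \<open>Commutators of unipotent operators on a complete flag of length 4\<close>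

text \<open>A unipotent operator minus 1 lowers the flag by one step, a ring commutator by two, and
  two of these by four. If \<open>Xi\<close> and \<open>Yi\<close> are the inverses of
  \<open>X\<close> and \<open>Y\<close>, the factor \<open>(X * Y - Y * X) * Xi * Yi\<close> is the
  group commutator minus 1, and likewise for the other factor.\<close>

lemma commutator_flag:
  fixes X Y Xi Yi :: "('a::field, 'n::finite) endo"
  assumes F: "\<And>i. vec.subspace (F i)" "\<And>i. F i \<subseteq> F (Suc i)" "F 0 \<subseteq> {0}"
    and dim: "\<And>i. vec.dim (F (Suc i)) \<le> Suc (vec.dim (F i))"
    and inv: "\<And>Z i v. Z \<in> {X, Y, Xi, Yi} \<Longrightarrow> v \<in> F i \<Longrightarrow> Z \<star> v \<in> F i"
    and unip: "\<And>Z. Z \<in> {X, Y, Xi, Yi} \<Longrightarrow> (Z - 1) ^ k = 0"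
    and v: "v \<in> F 4"
  shows "((X * Y - Y * X) * Xi * Yi * ((Xi * Y - Y * Xi) * X * Yi)) \<star> v = 0"
    and "((Xi * Y - Y * Xi) * X * Yi * ((X * Y - Y * X) * Xi * Yi)) \<star> v = 0"
proof -
  have step: "(Z - 1) \<star> w \<in> F i" if "Z \<in> {X, Y, Xi, Yi}" "w \<in> F (Suc i)" for Z i w
    by (rule unipotent_step[OF F(1) F(1) F(2) dim inv[OF that(1)] inv[OF that(1)] unip[OF that(1)] that(2)])
  have comm: "(Z * Z' - Z' * Z) \<star> w \<in> F i"
    if "Z \<in> {X, Y, Xi, Yi}" "Z' \<in> {X, Y, Xi, Yi}" "w \<in> F (Suc (Suc i))" for Z Z' i w
  proof -
    have "Z * Z' - Z' * Z = (Z - 1) * (Z' - 1) - (Z' - 1) * (Z - 1)" by (simp add: algebra_simps)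
    then have "(Z * Z' - Z' * Z) \<star> w = (Z - 1) \<star> (Z' - 1) \<star> w - (Z' - 1) \<star> (Z - 1) \<star> w"
      by (simp only: ap_simps(3,5))
    also have "\<dots> \<in> F i" using step[OF that(1) step[OF that(2,3)]] step[OF that(2) step[OF that(1,3)]]
      by (rule vec.subspace_diff[OF F(1)])
    finally show ?thesis .
  qed
  have v4: "v \<in> F (Suc (Suc (Suc (Suc 0))))" using v by (simp add: numeral_eq_Suc)
  have 1: "Z1 \<star> Z2 \<star> v \<in> F (Suc (Suc (Suc (Suc 0))))"
    if "Z1 \<in> {X, Y, Xi, Yi}" "Z2 \<in> {X, Y, Xi, Yi}" for Z1 Z2
    by (rule inv[OF that(1) inv[OF that(2) v4]])
  have 2: "Z1 \<star> Z2 \<star> (Z3 * Z4 - Z4 * Z3) \<star> Z5 \<star> Z6 \<star> v \<in> F (Suc (Suc 0))"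
    if "Z1 \<in> {X, Y, Xi, Yi}" "Z2 \<in> {X, Y, Xi, Yi}" "Z3 \<in> {X, Y, Xi, Yi}" "Z4 \<in> {X, Y, Xi, Yi}"
      "Z5 \<in> {X, Y, Xi, Yi}" "Z6 \<in> {X, Y, Xi, Yi}" for Z1 Z2 Z3 Z4 Z5 Z6
    by (rule inv[OF that(1) inv[OF that(2) comm[OF that(3,4) 1[OF that(5,6)]]]])
  have "(X * Y - Y * X) \<star> Xi \<star> Yi \<star> (Xi * Y - Y * Xi) \<star> X \<star> Yi \<star> v \<in> F 0"
    by (rule comm[OF _ _ 2]) simp_all
  then have "(X * Y - Y * X) \<star> Xi \<star> Yi \<star> (Xi * Y - Y * Xi) \<star> X \<star> Yi \<star> v = 0" using F(3) by blast
  then show "((X * Y - Y * X) * Xi * Yi * ((Xi * Y - Y * Xi) * X * Yi)) \<star> v = 0"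
    by (simp only: ap_simps(3))
  have "(Xi * Y - Y * Xi) \<star> X \<star> Yi \<star> (X * Y - Y * X) \<star> Xi \<star> Yi \<star> v \<in> F 0"
    by (rule comm[OF _ _ 2]) simp_all
  then have "(Xi * Y - Y * Xi) \<star> X \<star> Yi \<star> (X * Y - Y * X) \<star> Xi \<star> Yi \<star> v = 0" using F(3) by blast
  then show "((Xi * Y - Y * Xi) * X * Yi * ((X * Y - Y * X) * Xi * Yi)) \<star> v = 0"
    by (simp only: ap_simps(3))
qed

lemma power_commute_ap: "(X * Y = Y * X) \<Longrightarrow> (X ^ i) \<star> Y \<star> v = Y \<star> (X ^ i) \<star> v"
  by (metis ap_simps(3) commute_power)

context
  fixes N :: "('a::field, 'n::finite) endo" and W :: "('a ^ 'n) set"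
  assumes W: "vec.subspace W"
    and NW: "\<And>v. v \<in> W \<Longrightarrow> N \<star> v \<in> W"
    and nil: "\<And>v. v \<in> W \<Longrightarrow> \<exists>k. (N ^ k) \<star> v = 0"
begin

definition Ker :: "nat \<Rightarrow> ('a ^ 'n) set" where
  "Ker i = {v \<in> W. (N ^ i) \<star> v = 0}"

lemma subspace_Ker: "vec.subspace (Ker i)"
  unfolding Ker_def by (rule subspace_ker[OF W])

lemma Ker_mono: "i \<le> j \<Longrightarrow> Ker i \<subseteq> Ker j"
  unfolding Ker_def using power_kills_mono by blast

text \<open>Induction on the exponent that kills \<open>v\<close>: \<open>N \<star> v\<close> needs
  one power less and so lies in \<open>Ker i\<close>, which puts \<open>v\<close> into
  \<open>Ker (Suc i)\<close>.\<close>

lemma Ker_stable: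
  assumes "Ker (Suc i) \<subseteq> Ker i" shows "W \<subseteq> Ker i"
proof -
  have "v \<in> Ker i" if "v \<in> W" "(N ^ k) \<star> v = 0" for k v
    using that
  proof (induction k arbitrary: v)
    case 0
    then show ?case using subspace_Ker vec.subspace_0 by auto
  next
    case (Suc k)
    have "N \<star> v \<in> Ker i"
      using Suc.prems by (intro Suc.IH NW) (simp_all only: power_Suc2 ap_simps)
    then have "v \<in> Ker (Suc i)" using Suc.prems(1) unfolding Ker_def power_Suc2 by simp
    then show ?case using assms by blast
  qed
  then show ?thesis using nil by blast
qed

lemma dim_Ker_less:
  assumes "\<not> W \<subseteq> Ker i" shows "vec.dim (Ker i) < vec.dim (Ker (Suc i))"
proof (rule ccontr)
  assume "\<not> ?thesis"
  then have "Ker i = Ker (Suc i)"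
    by (intro vec.subspace_dim_equal subspace_Ker Ker_mono) auto
  then show False using Ker_stable assms by blast
qed

lemma dim_Ker_ge:
  assumes "\<not> W \<subseteq> Ker i" shows "Suc i \<le> vec.dim (Ker (Suc i))"
  using assms
proof (induction i)
  case (Suc i)
  then have "\<not> W \<subseteq> Ker i" using Ker_mono[of i "Suc i"] by auto
  then show ?case using Suc dim_Ker_less[of "Suc i"] by linarith
qed (use dim_Ker_less in fastforce)

text \<open>With \<open>N\<close> not of square zero on \<open>W\<close>, its Jordan type there is
  (4), (3,1) or (3). In each case kernels and images of powers of \<open>N\<close> contain a
  complete flag, and whatever commutes with \<open>N\<close> preserves it.\<close>

lemma commutators_of_centralizer:
  assumes dimW: "vec.dim W \<le> 4" and sq: "\<not> W \<subseteq> Ker 2"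
    and comm: "\<And>Z. Z \<in> {X, Y, Xi, Yi} \<Longrightarrow> N * Z = Z * N"
    and inv: "\<And>Z v. Z \<in> {X, Y, Xi, Yi} \<Longrightarrow> v \<in> W \<Longrightarrow> Z \<star> v \<in> W"
    and unip: "\<And>Z. Z \<in> {X, Y, Xi, Yi} \<Longrightarrow> (Z - 1) ^ k = 0"
    and v: "v \<in> W"
  shows "((X * Y - Y * X) * Xi * Yi * ((Xi * Y - Y * Xi) * X * Yi)) \<star> v = 0"
    and "((Xi * Y - Y * Xi) * X * Yi * ((X * Y - Y * X) * Xi * Yi)) \<star> v = 0"
proof -
  have invK: "Z \<star> w \<in> Ker i" if "Z \<in> {X, Y, Xi, Yi}" "w \<in> Ker i" for Z i w
    using that(2) inv[OF that(1)] power_commute_ap[OF comm[OF that(1)], of i w]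
    by (simp add: Ker_def)
  have "\<exists>F. (\<forall>i. vec.subspace (F i)) \<and> (\<forall>i. F i \<subseteq> F (Suc i)) \<and> F 0 \<subseteq> {0} \<and> v \<in> F 4 \<and>
      (\<forall>i. vec.dim (F (Suc i)) \<le> Suc (vec.dim (F i))) \<and>
      (\<forall>Z i w. Z \<in> {X, Y, Xi, Yi} \<longrightarrow> w \<in> F i \<longrightarrow> Z \<star> w \<in> F i)"
    \<comment> \<open>the flag consists of the kernels of the powers of \<open>N\<close> if \<open>N\<^sup>3 \<noteq> 0\<close>, and otherwise of
      \<open>0 \<subseteq> N\<^sup>2 W \<subseteq> ker N \<subseteq> ker N\<^sup>2 \<subseteq> W\<close>\<close>
  proof (cases "W \<subseteq> Ker 3")
    case False
    have dle: "vec.dim (Ker i) \<le> 4" for i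
      using vec.dim_subset[of "Ker i" W] dimW by (auto simp: Ker_def)
    have d4: "4 \<le> vec.dim (Ker 4)" using dim_Ker_ge[OF False] by simp
    have "W \<subseteq> Ker 4"
    proof (rule ccontr)
      assume "\<not> W \<subseteq> Ker 4"
      from dim_Ker_less[OF this] d4 dle[of "Suc 4"] show False by linarith
    qed
    have nW: "\<not> W \<subseteq> Ker i" if "i \<le> 3" for i using False Ker_mono[OF that] by blast
    have d: "vec.dim (Ker 0) < vec.dim (Ker 1)" "vec.dim (Ker 1) < vec.dim (Ker 2)"
      "vec.dim (Ker 2) < vec.dim (Ker 3)" "vec.dim (Ker 3) < vec.dim (Ker 4)"
      using dim_Ker_less[OF nW, of 0] dim_Ker_less[OF nW, of 1]
        dim_Ker_less[OF nW, of 2] dim_Ker_less[OF nW, of 3] by (simp_all add: eval_nat_numeral)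
    have "vec.dim (Ker (Suc i)) \<le> Suc (vec.dim (Ker i))" for i
    proof -
      consider "i = 0" | "i = 1" | "i = 2" | "i = 3" | "4 \<le> i" by linarith
      then show ?thesis
      proof cases
        case 5
        then show ?thesis using vec.dim_subset[OF Ker_mono[OF 5]] d4 dle[of "Suc i"] by linarith
      qed (use d dle[of 4] in \<open>simp_all add: eval_nat_numeral\<close>)
    qed
    then show ?thesis
      using subspace_Ker Ker_mono[of _ "Suc _"] invK \<open>W \<subseteq> Ker 4\<close> v
      by (intro exI[of _ Ker]) (auto simp: Ker_def)
  next
    case True
    let ?I = "ap (N ^ 2) ` W"
    have I1: "?I \<subseteq> Ker 1"
    proof
      fix w assume "w \<in> ?I"
      then obtain u where u: "u \<in> W" "w = (N ^ 2) \<star> u" by blast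
      then have "N \<star> w = 0" using True by (auto simp: Ker_def eval_nat_numeral)
      moreover have "w \<in> W" using u NW by (simp add: power2_eq_square)
      ultimately show "w \<in> Ker 1" by (simp add: Ker_def)
    qed
    \<comment> \<open>Below, the numbers \<open>dim N^2 W\<close>,
      \<open>dim Ker 2 - dim Ker 1\<close> and \<open>dim Ker 1\<close> are shown to increase weakly
      from at least 1. Their sum is \<open>dim W\<close>, at most 4, so the first two are 1 and the
      last is at most 2.\<close>
    have r1: "vec.dim ?I + vec.dim (Ker 2) = vec.dim W"
      using rank_nullity[OF W, of "N ^ 2"] by (simp add: Ker_def)
    have "{w \<in> Ker 2. N \<star> w = 0} = Ker 1" by (auto simp: Ker_def power2_eq_square)
    then have r2: "vec.dim (ap N ` Ker 2) + vec.dim (Ker 1) = vec.dim (Ker 2)"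
      using rank_nullity[OF subspace_Ker, of N 2] by simp
    have "?I \<subseteq> ap N ` Ker 2"
    proof
      fix w assume "w \<in> ?I"
      then obtain u where u: "u \<in> W" "w = N \<star> N \<star> u" by (auto simp: power2_eq_square)
      then have "N \<star> u \<in> Ker 2" using NW True by (auto simp: Ker_def eval_nat_numeral)
      then show "w \<in> ap N ` Ker 2" using u by blast
    qed
    then have r3: "vec.dim ?I \<le> vec.dim (ap N ` Ker 2)" by (rule vec.dim_subset)
    have "ap N ` Ker 2 \<subseteq> Ker 1" using NW by (auto simp: Ker_def power2_eq_square)
    then have r4: "vec.dim (ap N ` Ker 2) \<le> vec.dim (Ker 1)" by (rule vec.dim_subset)
    have r5: "vec.dim (Ker 2) < vec.dim W"
    proof (rule ccontr)
      assume "\<not> ?thesis"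
      then have "Ker 2 = W" by (intro vec.subspace_dim_equal subspace_Ker W) (auto simp: Ker_def)
      then show False using sq by blast
    qed
    define F where "F i = (if i = 0 then {0} else if i = 1 then ?I else if i = 2 then Ker 1
      else if i = 3 then Ker 2 else W)" for i :: nat
    have F: "F 0 = {0}" "F (Suc 0) = ?I" "F (Suc (Suc 0)) = Ker 1" "F (Suc (Suc (Suc 0))) = Ker 2"
      "F (Suc (Suc (Suc (Suc i)))) = W" for i
      by (simp_all add: F_def)
    have cs: "i = 0 \<or> i = Suc 0 \<or> i = Suc (Suc 0) \<or> i = Suc (Suc (Suc 0)) \<or>
        (\<exists>j. i = Suc (Suc (Suc (Suc j))))" for i
      by (metis not0_implies_Suc)
    have invI: "Z \<star> w \<in> ?I" if "Z \<in> {X, Y, Xi, Yi}" "w \<in> ?I" for Z w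
    proof -
      obtain u where u: "u \<in> W" "w = (N ^ 2) \<star> u" using \<open>w \<in> ?I\<close> by blast
      then have "Z \<star> w = (N ^ 2) \<star> Z \<star> u" using power_commute_ap[OF comm[OF that(1)]] by simp
      then show ?thesis using inv[OF that(1) u(1)] by blast
    qed
    have 1: "vec.subspace (F i)" for i
      using cs[of i] by (auto simp: F subspace_Ker W subspace_ap_image)
    have 2: "F i \<subseteq> F (Suc i)" for i
    proof -
      have "{0} \<subseteq> ?I" using vec.subspace_0[OF subspace_ap_image[OF W]] by blast
      moreover have "Ker 1 \<subseteq> Ker 2" by (rule Ker_mono) simp
      moreover have "Ker 2 \<subseteq> W" by (auto simp: Ker_def)
      ultimately show ?thesis using cs[of i] I1 by (elim disjE exE) (simp_all only: F order_refl)
    qed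
    have 3: "vec.dim (F (Suc i)) \<le> Suc (vec.dim (F i))" for i
    proof -
      have "vec.dim ?I \<le> Suc 0" "vec.dim (Ker 1) \<le> Suc (vec.dim ?I)"
        "vec.dim (Ker 2) \<le> Suc (vec.dim (Ker 1))" "vec.dim W \<le> Suc (vec.dim (Ker 2))"
        using r1 r2 r3 r4 r5 dimW by linarith+
      moreover have "vec.dim {0 :: 'a ^ 'n} = 0" by simp
      ultimately show ?thesis using cs[of i] by (elim disjE exE) (simp_all only: F)
    qed
    have 4: "Z \<star> w \<in> F i" if "Z \<in> {X, Y, Xi, Yi}" "w \<in> F i" for Z i w
    proof -
      show ?thesis
        using cs[of i] that(2) invI[OF that(1)] invK[OF that(1)] inv[OF that(1)]
        by (elim disjE exE) (simp_all only: F singleton_iff ap_lin)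
    qed
    have "v \<in> F 4" using v by (simp add: F_def)
    then show ?thesis using 1 2 3 4 F(1) by (intro exI[of _ F]) simp
  qed
  then obtain F where F: "\<And>i. vec.subspace (F i)" "\<And>i. F i \<subseteq> F (Suc i)" "F 0 \<subseteq> {0}" "v \<in> F 4"
    and F': "\<And>i. vec.dim (F (Suc i)) \<le> Suc (vec.dim (F i))"
      "\<And>Z i w. Z \<in> {X, Y, Xi, Yi} \<Longrightarrow> w \<in> F i \<Longrightarrow> Z \<star> w \<in> F i" by metis
  show "((X * Y - Y * X) * Xi * Yi * ((Xi * Y - Y * Xi) * X * Yi)) \<star> v = 0"
    by (rule commutator_flag(1)[where F = F, OF F(1-3) F' unip F(4)])
  show "((Xi * Y - Y * Xi) * X * Yi * ((X * Y - Y * X) * Xi * Yi)) \<star> v = 0"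
    by (rule commutator_flag(2)[where F = F, OF F(1-3) F' unip F(4)])
qed

end

section \<open>The case of square zero\<close>

text \<open>Here \<open>N\<close> is \<open>t/s - 1\<close>, \<open>M\<close> is
  \<open>a - 1\<close> and \<open>M'\<close> is \<open>y - 1\<close>. The operators \<open>P\<close>
  and \<open>Q\<close> of the proof are conjugate to \<open>N\<close> by \<open>b\<close> and
  \<open>c\<close>, hence of square zero on \<open>W\<close>. This forces
  \<open>M^2 = N M = 0\<close>, so that \<open>N\<close>, \<open>N + M\<close> and
  \<open>N + 2 M\<close> are conjugate on \<open>W\<close>; the rest is a discussion of their common
  rank.\<close>

lemma square_zero_case:
  fixes N M M' b bi c ci :: "('a::field, 'n::finite) endo"
  assumes W: "vec.subspace W" and dimW: "vec.dim W \<le> 4" and two: "(2 :: 'a) \<noteq> 0"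
    and comm: "N * M = M * N" "N * M' = M' * N"
    and b: "b * bi = 1" "bi * b = 1" and c: "c * ci = 1" "ci * c = 1"
    and inv: "\<And>Z v. Z \<in> {N, M, M', b, bi, c, ci} \<Longrightarrow> v \<in> W \<Longrightarrow> Z \<star> v \<in> W"
    and sq: "\<And>v. v \<in> W \<Longrightarrow> N \<star> N \<star> v = 0"
    and Nb: "N * b = b * ((1 + N) * (1 + M) - 1)"
    and Nc: "N * c = c * ((1 + N) * (1 + M) * (1 + M) - 1)"
    and M': "M' = b * M * bi"
    and v: "v \<in> W"
  shows "M \<star> M' \<star> v = 0" "M' \<star> M \<star> v = 0"
proof -
  have WN: "N \<star> w \<in> W" and WM: "M \<star> w \<in> W" and WM': "M' \<star> w \<in> W" and Wb: "b \<star> w \<in> W"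
    and Wbi: "bi \<star> w \<in> W" and Wc: "c \<star> w \<in> W" and Wci: "ci \<star> w \<in> W" if "w \<in> W" for w
    using inv that by auto
  have dbl: "x = 0" if "x + x = 0" for x :: "'a ^ 'n"
  proof -
    have "(2 :: 'a) *s x = 0" using that by (simp add: vec_eq_iff)
    then show ?thesis using two by simp
  qed
  have NM: "M \<star> N \<star> w = N \<star> M \<star> w" and NM': "M' \<star> N \<star> w = N \<star> M' \<star> w" for w
    using comm by (metis ap_simps(3))+
  have bbi: "b \<star> bi \<star> w = w" "bi \<star> b \<star> w = w" for w using b by (metis ap_simps(2,3))+
  have cci: "c \<star> ci \<star> w = w" "ci \<star> c \<star> w = w" for w using c by (metis ap_simps(2,3))+
  define P where "P = (1 + N) * (1 + M) - 1"
  define Q where "Q = (1 + N) * (1 + M) * (1 + M) - 1"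
  have Pw: "P \<star> w = N \<star> w + M \<star> w + N \<star> M \<star> w" for w
    by (simp add: P_def algebra_simps)
  have Qw: "Q \<star> w = N \<star> w + (M \<star> w + M \<star> w + M \<star> M \<star> w)
      + (N \<star> M \<star> w + N \<star> M \<star> w + N \<star> M \<star> M \<star> w)" for w
    by (simp add: Q_def algebra_simps)
  have Nbw: "N \<star> b \<star> w = b \<star> P \<star> w" for w using Nb unfolding P_def[symmetric] by (metis ap_simps(3))
  have Ncw: "N \<star> c \<star> w = c \<star> Q \<star> w" for w using Nc unfolding Q_def[symmetric] by (metis ap_simps(3))
  have PP: "P \<star> P \<star> w = 0" if "w \<in> W" for w
  proof -
    have "b \<star> P \<star> P \<star> w = N \<star> N \<star> b \<star> w" by (simp only: Nbw)
    then show ?thesis using sq[OF Wb[OF that]] bbi(2) by (metis ap_lin(4))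
  qed
  have QQ: "Q \<star> Q \<star> w = 0" if "w \<in> W" for w
  proof -
    have "c \<star> Q \<star> Q \<star> w = N \<star> N \<star> c \<star> w" by (simp only: Ncw)
    then show ?thesis using sq[OF Wc[OF that]] cci(2) by (metis ap_lin(4))
  qed
  have i: "M \<star> M \<star> w + (N \<star> M \<star> w + N \<star> M \<star> w) + (N \<star> M \<star> M \<star> w + N \<star> M \<star> M \<star> w) = 0" if "w \<in> W" for w
    using PP[OF that] by (simp add: Pw NM sq that WM algebra_simps)
  \<comment> \<open>Applying \<open>N\<close> to \<open>i\<close> kills every term with a second
    factor \<open>N\<close>.\<close>
  have NMM: "N \<star> M \<star> M \<star> w = 0" if "w \<in> W" for w
  proof -
    have "N \<star> (M \<star> M \<star> w + (N \<star> M \<star> w + N \<star> M \<star> w) + (N \<star> M \<star> M \<star> w + N \<star> M \<star> M \<star> w)) = 0"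
      by (simp only: i[OF that] ap_lin)
    then show ?thesis by (simp only: ap_lin sq[OF WM[OF that]] sq[OF WM[OF WM[OF that]]] add_0_right)
  qed
  have i': "M \<star> M \<star> w + (N \<star> M \<star> w + N \<star> M \<star> w) = 0" if "w \<in> W" for w
    using i[OF that] NMM[OF that] by simp
  have MMM: "M \<star> M \<star> M \<star> w = 0" if "w \<in> W" for w
    using i'[OF WM[OF that]] NMM[OF that] by simp
  have ii: "M \<star> M \<star> w + M \<star> M \<star> w + (M \<star> M \<star> w + M \<star> M \<star> w)
     + (N \<star> M \<star> w + N \<star> M \<star> w + (N \<star> M \<star> w + N \<star> M \<star> w)) = 0" if "w \<in> W" for w
  proof -
    have NQ: "N \<star> Q \<star> w = N \<star> M \<star> w + N \<star> M \<star> w"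
      by (simp only: Qw[of w] ap_lin NM sq NMM MMM WM that add_0_left add_0_right)
    have MQ: "M \<star> Q \<star> w = N \<star> M \<star> w + (M \<star> M \<star> w + M \<star> M \<star> w)"
      by (simp only: Qw[of w] ap_lin NM sq NMM MMM WM that add_0_left add_0_right)
    have "N \<star> M \<star> w + N \<star> M \<star> w + (N \<star> M \<star> w + (M \<star> M \<star> w + M \<star> M \<star> w)
        + (N \<star> M \<star> w + (M \<star> M \<star> w + M \<star> M \<star> w))) = 0"
      using QQ[OF that] by (simp only: Qw[of "Q \<star> w"] NQ MQ ap_lin NM sq NMM MMM WM that add_0_left add_0_right)
    then show ?thesis by (simp only: ac_simps)
  qed
  \<comment> \<open>Subtracting twice \<open>i'\<close> from \<open>ii\<close> leaves
    \<open>2 M^2 = 0\<close>.\<close>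
  have MM: "M \<star> M \<star> w = 0" if "w \<in> W" for w
  proof -
    have "M \<star> M \<star> w + M \<star> M \<star> w + ((M \<star> M \<star> w + (N \<star> M \<star> w + N \<star> M \<star> w)) +
       (M \<star> M \<star> w + (N \<star> M \<star> w + N \<star> M \<star> w))) = 0"
      using ii[OF that] by (simp only: ac_simps)
    then have "M \<star> M \<star> w + M \<star> M \<star> w = 0" by (simp only: i'[OF that] add_0_right)
    then show ?thesis by (rule dbl)
  qed
  have NM0: "N \<star> M \<star> w = 0" if "w \<in> W" for w
    using i'[OF that] unfolding MM[OF that] add_0_left by (rule dbl)
  have Pv: "P \<star> w = N \<star> w + M \<star> w" and Qv: "Q \<star> w = N \<star> w + M \<star> w + M \<star> w" if "w \<in> W" for w
    using that by (simp_all add: Pw Qw NM0 MM WM)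
  have NM'0: "N \<star> M' \<star> w = 0" if "w \<in> W" for w
  proof -
    have "P \<star> M \<star> bi \<star> w = 0" using that by (simp add: Pv WM Wbi NM0 MM)
    then show ?thesis by (simp add: M' Nbw)
  qed
  define I where "I = ap N ` W"
  define K where "K = {w \<in> W. N \<star> w = 0}"
  have sI: "vec.subspace I" unfolding I_def by (rule subspace_ap_image[OF W])
  have sK: "vec.subspace K" unfolding K_def by (rule subspace_ker[OF W])
  have rn: "vec.dim I + vec.dim K = vec.dim W" unfolding I_def K_def by (rule rank_nullity[OF W])
  have IK: "I \<subseteq> K" using sq WN by (auto simp: I_def K_def)
  have MI: "M \<star> w = 0" and M'I: "M' \<star> w = 0" if "w \<in> I" for w
    using that NM0 NM'0 by (auto simp: I_def NM NM')
  have MK: "M \<star> w \<in> K" and M'K: "M' \<star> w \<in> K" if "w \<in> W" for w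
    using that NM0 NM'0 WM WM' by (auto simp: K_def)
  have M'w: "M' \<star> w = b \<star> M \<star> bi \<star> w" for w by (simp add: M')
  have "M \<star> M' \<star> v = 0 \<and> M' \<star> M \<star> v = 0"
  proof (cases "2 \<le> vec.dim I")
    case True
    \<comment> \<open>The dimensions of \<open>I\<close> and \<open>K\<close> add up to at most 4,
      so \<open>K\<close> has dimension at most 2. Both \<open>M\<close> and \<open>M'\<close> map
      \<open>W\<close> into \<open>K\<close> and vanish on \<open>I\<close>.\<close>
    then have "I = K" using rn dimW by (intro vec.subspace_dim_equal sI sK IK) linarith
    then show ?thesis using MI M'I MK[OF v] M'K[OF v] by simp
  next
    case False
    have Pbi: "P \<star> w = bi \<star> N \<star> b \<star> w" and Qci: "Q \<star> w = ci \<star> N \<star> c \<star> w" for w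
      by (simp_all add: Nbw Ncw bbi cci)
    have sub: "ap P ` W \<subseteq> ap bi ` I" "ap Q ` W \<subseteq> ap ci ` I"
      using Wb Wc by (auto simp: I_def Pbi Qci)
    have dP: "vec.dim (ap P ` W) \<le> 1" and dQ: "vec.dim (ap Q ` W) \<le> 1"
      using vec.dim_subset[OF sub(1)] vec.dim_subset[OF sub(2)] False
        vec.dim_image_le[OF linear_ap, of bi I] vec.dim_image_le[OF linear_ap, of ci I] by linarith+
    \<comment> \<open>\<open>N\<close>, \<open>N + M\<close> and \<open>N + 2 M\<close> have rank at most 1 on \<open>W\<close>\<close>
    have dich: "ap M ` W \<subseteq> I \<or> (\<forall>k\<in>K. M \<star> k = 0)"
    proof (rule disjCI)
      \<comment> \<open>For \<open>k\<close> in the kernel of \<open>N\<close>,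
        \<open>M \<star> k\<close> is the image of \<open>k\<close> under \<open>P\<close> and of
        \<open>k/2\<close> under \<open>Q\<close>, so if nonzero it spans both images. Then
        \<open>M = Q - P\<close> and \<open>N = P - M\<close> map into this line as well, and
        \<open>N\<close> is nonzero because it is conjugate to \<open>P\<close>.\<close>
      assume "\<not> (\<forall>k\<in>K. M \<star> k = 0)"
      then obtain k where k: "k \<in> W" "N \<star> k = 0" "M \<star> k \<noteq> 0" by (auto simp: K_def)
      let ?m = "M \<star> k"
      have line: "U = vec.span {?m}" if "vec.subspace U" "vec.dim U \<le> 1" "?m \<in> U" for U
      proof (rule vec.subspace_dim_equal[symmetric])
        show "vec.span {?m} \<subseteq> U" using that by (intro vec.span_minimal) auto
        show "vec.dim U \<le> vec.dim (vec.span {?m})" using that(2) k(3) by simp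
      qed (use that in auto)
      have "?m = P \<star> k" using k by (simp add: Pv)
      then have P: "ap P ` W = vec.span {?m}"
        using k(1) by (intro line subspace_ap_image W dP) blast
      have "?m = Q \<star> (inverse 2 *s k)"
        using k two by (simp add: Qv vec_eq_iff field_simps)
      then have Q: "ap Q ` W = vec.span {?m}"
        using k(1) by (intro line subspace_ap_image W dQ) (use vec.subspace_scale[OF W] in blast)
      have Mm: "M \<star> w \<in> vec.span {?m}" if "w \<in> W" for w
      proof -
        have "Q \<star> w - P \<star> w \<in> vec.span {?m}"
          using that P Q by (intro vec.span_diff) blast+
        then show ?thesis using that by (simp add: Pv Qv)
      qed
      have Im: "I \<subseteq> vec.span {?m}"
      proof
        fix x assume "x \<in> I"
        then obtain w where w: "w \<in> W" "x = N \<star> w" by (auto simp: I_def)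
        have "P \<star> w - M \<star> w \<in> vec.span {?m}"
          using w(1) P Mm by (intro vec.span_diff) blast+
        then show "x \<in> vec.span {?m}" using w by (simp add: Pv)
      qed
      have "vec.dim I \<noteq> 0"
      proof
        assume "vec.dim I = 0"
        then have "I \<subseteq> {0}" by simp
        then have "N \<star> b \<star> k = 0" using Wb[OF k(1)] by (auto simp: I_def)
        then have "P \<star> k = 0" by (simp add: Pbi)
        then show False using k by (simp add: Pv)
      qed
      moreover have "vec.dim (vec.span {?m}) = 1" using k(3) by simp
      ultimately have "vec.dim (vec.span {?m}) \<le> vec.dim I" by linarith
      then have "I = vec.span {?m}"
        by (intro vec.subspace_dim_equal sI Im vec.subspace_span)
      then show "ap M ` W \<subseteq> I" using Mm by blast
    qed
    then show ?thesis
    proof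
      assume A: "ap M ` W \<subseteq> I"
      \<comment> \<open>Since \<open>N b = b P\<close>, the image of \<open>I\<close> under
        \<open>bi\<close> lies in the image of \<open>P = N + M\<close>, hence in \<open>I\<close>.
        By dimension \<open>b\<close> preserves \<open>I\<close> too, so \<open>M'\<close> maps into
        \<open>I\<close>, where both operators vanish.\<close>
      have biI: "bi \<star> x \<in> I" if x: "x \<in> I" for x
      proof -
        obtain w where w: "w \<in> W" "x = N \<star> w" using x by (auto simp: I_def)
        have "bi \<star> x = P \<star> bi \<star> w" by (simp add: w Pbi bbi)
        also have "\<dots> = N \<star> bi \<star> w + M \<star> bi \<star> w" using w by (simp add: Pv Wbi)
        also have "\<dots> \<in> I" using A Wbi[OF w(1)] by (intro vec.subspace_add sI) (auto simp: I_def)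
        finally show ?thesis .
      qed
      have "M \<star> bi \<star> v \<in> I" using A Wbi[OF v] by blast
      from inverse_invariant[OF b(1) sI biI this] have "M' \<star> v \<in> I" unfolding M'w .
      moreover have "M \<star> v \<in> I" using A v by blast
      ultimately show ?thesis using MI M'I by blast
    next
      assume B: "\<forall>k\<in>K. M \<star> k = 0"
      \<comment> \<open>\<open>P = N + M\<close> vanishes on \<open>K\<close>, so
        \<open>N b = b P\<close> shows that \<open>b\<close> preserves \<open>K\<close>, and then so
        does \<open>bi\<close>.\<close>
      have bK: "b \<star> k \<in> K" if "k \<in> K" for k
        using that B Wb by (simp add: K_def Nbw Pv)
      have "bi \<star> M \<star> v \<in> K" by (rule inverse_invariant[OF b(2) sK bK MK[OF v]])
      then show ?thesis using B M'K[OF v] by (simp add: M'w)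
    qed
  qed
  then show "M \<star> M' \<star> v = 0" "M' \<star> M \<star> v = 0" by auto
qed

section \<open>Unipotent elements, intertwiners and the unipotent case of the relations\<close>

lemma commute_inverse:
  fixes X :: "'r::monoid_mult"
  assumes "X * Xi = 1" "Xi * X = 1" "X * T = T * X" shows "Xi * T = T * Xi"
proof -
  have "Xi * T = Xi * (T * X) * Xi" using assms(1) by (simp add: mult.assoc)
  also have "\<dots> = T * Xi" using assms(2) unfolding assms(3)[symmetric] by (simp flip: mult.assoc)
  finally show ?thesis .
qed

lemma power_mult_commute:
  fixes X :: "'r::monoid_mult"
  assumes "X * Y = Y * X" shows "(X * Y) ^ k = X ^ k * Y ^ k"
proof (induction k)
  case (Suc k)
  have "X * (Y * X ^ k) * Y ^ k = X * (X ^ k * Y) * Y ^ k"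
    using commute_power[of Y X k] assms by simp
  then show ?case unfolding power_Suc Suc by (simp only: mult.assoc)
qed simp

lemma unipotent_inverse:
  fixes a :: "'r::ring_1"
  assumes "a * ai = 1" "ai * a = 1" "(a - 1) ^ k = 0" shows "(ai - 1) ^ k = 0"
proof -
  have "ai - 1 = (- ai) * (a - 1)" using assms(2) by (simp add: algebra_simps)
  moreover have "(- ai) * (a - 1) = (a - 1) * (- ai)" using assms(1,2) by (simp add: algebra_simps)
  ultimately show ?thesis using power_mult_commute assms(3) by (metis mult_zero_right)
qed

lemma unipotent_square:
  fixes a :: "'r::ring_1"
  assumes "(a - 1) ^ k = 0" shows "(a * a - 1) ^ k = 0"
proof -
  have "a * a - 1 = (a + 1) * (a - 1)" "(a + 1) * (a - 1) = (a - 1) * (a + 1)"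
    by (simp_all add: algebra_simps)
  then show ?thesis using power_mult_commute assms by (metis mult_zero_right)
qed

lemma power_conj:
  fixes b :: "'r::monoid_mult"
  assumes "bi * b = 1" "b * bi = 1" shows "(b * x * bi) ^ k = b * x ^ k * bi"
proof (induction k)
  case (Suc k)
  have "(b * x * bi) ^ Suc k = b * x * (bi * b) * x ^ k * bi" using Suc by (simp add: mult.assoc)
  then show ?case by (simp add: assms(1) mult.assoc)
qed (simp add: assms(2))

lemma gen_intertwine:
  assumes "T * b = b * S" "v \<in> gen S r" shows "b \<star> v \<in> gen T r"
proof -
  have 1: "(T - scal r) * b = b * (S - scal r)"
    by (simp only: left_diff_distrib right_diff_distrib assms(1) scal_commute)
  have "(T - scal r) ^ k * b = b * (S - scal r) ^ k" for k
  proof (induction k)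
    case (Suc k)
    have "(T - scal r) ^ Suc k * b = (T - scal r) * ((T - scal r) ^ k * b)" by (simp only: power_Suc mult.assoc)
    also have "\<dots> = b * (S - scal r) ^ Suc k" unfolding Suc power_Suc mult.assoc[symmetric] 1 ..
    finally show ?case .
  qed simp
  then have *: "((T - scal r) ^ k) \<star> b \<star> v = b \<star> ((S - scal r) ^ k) \<star> v" for k by (metis ap_simps(3))
  obtain k where "((S - scal r) ^ k) \<star> v = 0" using assms(2) by (auto simp: gen_def)
  with *[of k] have "((T - scal r) ^ k) \<star> b \<star> v = 0" by simp
  then show ?thesis unfolding gen_def by blast
qed

lemma gen_zero_trivial:
  assumes "ti * t = 1" "v \<in> gen t 0" shows "v = 0"
proof -
  have inj: "w = 0" if "t \<star> w = 0" for w
    using that assms(1) by (metis ap_simps(2,3) ap_lin(4))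
  have "w = 0" if "(t ^ k) \<star> w = 0" for k w
    using that by (induction k) (auto intro: inj)
  then show ?thesis using assms(2) by (auto simp: gen_def)
qed

lemma gen_normalized_nilpotent:
  assumes "s \<noteq> 0" "v \<in> gen t s" shows "\<exists>k. ((scal (inverse s) * t - 1) ^ k) \<star> v = 0"
proof -
  have "scal (inverse s) * scal s = 1" using assms(1) by (intro endo_eqI) (simp add: vector_smult_assoc)
  then have N: "scal (inverse s) * t - 1 = scal (inverse s) * (t - scal s)"
    by (simp add: right_diff_distrib)
  obtain k where "((t - scal s) ^ k) \<star> v = 0" using assms(2) by (auto simp: gen_def)
  then have "((scal (inverse s) * t - 1) ^ k) \<star> v = 0"
    unfolding N power_mult_commute[OF scal_commute] by (simp only: ap_simps(3) ap_lin(4))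
  then show ?thesis by blast
qed

text \<open>The identity is checked on each generalised eigenspace \<open>W\<close> of
  \<open>t\<close>. All operators involved preserve \<open>W\<close>, and \<open>?g1\<close>,
  \<open>?g2\<close> are the two commutators minus 1. Their products vanish on \<open>W\<close> in
  both orders, by \<open>square_zero_case\<close> or by
  \<open>commutators_of_centralizer\<close>.\<close>

lemma commutators_commute:
  fixes a ai b bi c ci t ti y yi :: "('a::alg_closed_field, 'n::finite) endo"
  assumes card: "CARD('n) \<le> 4" and two: "(2 :: 'a) \<noteq> 0"
    and a: "a * ai = 1" "ai * a = 1" and b: "b * bi = 1" "bi * b = 1"
    and c: "c * ci = 1" "ci * c = 1" and t: "t * ti = 1" "ti * t = 1"
    and ta: "a * t = t * a" and tb: "t * b = b * a * t" and tc: "t * c = c * a * a * t"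
    and unip: "(a - 1) ^ k = 0"
    and y: "y = b * a * bi" and yi: "yi = b * ai * bi"
  shows "(a * y * ai * yi) * (ai * y * a * yi) = (ai * y * a * yi) * (a * y * ai * yi)"
proof -
  let ?g1 = "(a * y - y * a) * ai * yi" and ?g2 = "(ai * y - y * ai) * a * yi"
  have bbi: "bi * (b * X) = X" "b * (bi * X) = X" for X using b by (simp_all flip: mult.assoc)
  have aai: "ai * (a * X) = X" "a * (ai * X) = X" for X using a by (simp_all flip: mult.assoc)
  have cci: "ci * (c * X) = X" for X using c by (simp flip: mult.assoc)
  have yyi: "y * yi = 1" "yi * y = 1" by (simp_all add: y yi mult.assoc bbi aai b)
  have unipi: "(ai - 1) ^ k = 0" by (rule unipotent_inverse[OF a unip])
  have "y - 1 = b * (a - 1) * bi" by (simp add: y algebra_simps b)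
  then have unipy: "(y - 1) ^ k = 0" by (simp add: power_conj[OF b(2,1)] unip)
  have unipyi: "(yi - 1) ^ k = 0" by (rule unipotent_inverse[OF yyi unipy])
  have bit: "bi * t = a * t * bi"
    using arg_cong[OF tb, of "\<lambda>X. bi * X * bi"] by (simp add: mult.assoc b bbi)
  have cit: "ci * t = a * a * t * ci"
    using arg_cong[OF tc, of "\<lambda>X. ci * X * ci"] by (simp add: mult.assoc c cci)
  \<comment> \<open>\<open>y\<close> is the conjugate by \<open>b\<close> of \<open>a\<close>, and
    \<open>t\<close> is the conjugate by \<open>b\<close> of \<open>a * t\<close>; the latter two
    commute.\<close>
  have ty: "y * t = t * y"
  proof -
    have "y * t = b * a * (a * t) * bi" by (simp add: y mult.assoc bit)
    also have "\<dots> = b * a * t * a * bi" unfolding ta by (simp only: mult.assoc)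
    also have "\<dots> = t * y" unfolding tb[symmetric] y by (simp only: mult.assoc)
    finally show ?thesis .
  qed
  have tai: "ai * t = t * ai" by (rule commute_inverse[OF a ta])
  have tyi: "yi * t = t * yi" by (rule commute_inverse[OF yyi ty])
  have zero: "(?g1 * ?g2) \<star> v = 0 \<and> (?g2 * ?g1) \<star> v = 0" if v: "v \<in> gen t s" for v s
  proof (cases "s = 0")
    case True
    then have "v = 0" using gen_zero_trivial[OF t(2)] v by blast
    then show ?thesis by (simp only: ap_lin)
  next
    case False
    define W where "W = gen t s"
    define N where "N = scal (inverse s) * t - 1"
    have W: "vec.subspace W" unfolding W_def by (rule subspace_gen)
    have dimW: "vec.dim W \<le> 4"
      using vec.dim_subset[of W UNIV] card unfolding vec_dim_card by simp
    define u where "u = scal (inverse s) * t"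
    \<comment> \<open>Scalars are central, so \<open>u\<close> satisfies every relation that
      \<open>t\<close> does, and its only eigenvalue on \<open>W\<close> is 1.\<close>
    have u: "u * Z = Z' * u" if "t * Z = Z' * t" for Z Z'
    proof -
      have "u * Z = Z' * t * scal (inverse s)" unfolding u_def mult.assoc that by (simp only: scal_commute mult.assoc)
      also have "\<dots> = Z' * u" unfolding u_def by (simp only: scal_commute mult.assoc)
      finally show ?thesis .
    qed
    have N: "N = u - 1" by (simp add: N_def u_def)
    have comm: "N * Z = Z * N" if "Z * t = t * Z" for Z
      using u[OF that[symmetric]] by (simp add: N left_diff_distrib right_diff_distrib)
    have WZ: "Z \<star> w \<in> W" if "Z * t = t * Z" "w \<in> W" for Z w
      using gen_invariant[OF that(1)] that(2) unfolding W_def .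
    have tn: "a * (t * X) = t * (a * X)" "ai * (t * X) = t * (ai * X)" for X
      by (simp_all only: mult.assoc[symmetric] ta tai)
    have "(a * a) * t = t * (a * a)" by (simp add: mult.assoc ta tn)
    \<comment> \<open>As \<open>a\<close> and \<open>ai\<close> are unipotent, \<open>t\<close>,
      \<open>a * t\<close> and \<open>a * a * t\<close> have the same generalised eigenspaces. Hence
      \<open>b\<close> and \<open>c\<close>, which intertwine them, preserve
      \<open>W\<close>.\<close>
    from gen_unipotent_subset[OF ta unip] gen_unipotent_subset[OF this unipotent_square[OF unip]]
    have sub: "gen t s \<subseteq> gen (a * t) s" "gen t s \<subseteq> gen (a * a * t) s" .
    have "ai * (a * t) = a * t * ai" "ai * ai * (a * a * t) = a * a * t * (ai * ai)"
      by (simp_all add: mult.assoc aai a ta tai tn)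
    from gen_unipotent_subset[OF this(1) unipi] gen_unipotent_subset[OF this(2) unipotent_square[OF unipi]]
    have sub': "gen (a * t) s \<subseteq> gen t s" "gen (a * a * t) s \<subseteq> gen t s"
      by (simp_all add: mult.assoc aai)
    have Wb: "b \<star> w \<in> W" if "w \<in> W" for w
      using that sub(1) gen_intertwine[of t b "a * t"] tb unfolding W_def by (auto simp: mult.assoc)
    have Wc: "c \<star> w \<in> W" if "w \<in> W" for w
      using that sub(2) gen_intertwine[of t c "a * a * t"] tc unfolding W_def by (auto simp: mult.assoc)
    have Wbi: "bi \<star> w \<in> W" if "w \<in> W" for w
      using that sub'(1) gen_intertwine[of "a * t" bi t] bit unfolding W_def by auto
    have Wci: "ci \<star> w \<in> W" if "w \<in> W" for w
      using that sub'(2) gen_intertwine[of "a * a * t" ci t] cit unfolding W_def by auto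
    have Nt: "N * t = t * N" by (rule comm) simp
    have NW: "N \<star> w \<in> W" if "w \<in> W" for w by (rule WZ[OF Nt that])
    have nil: "\<exists>k. (N ^ k) \<star> w = 0" if "w \<in> W" for w
      using gen_normalized_nilpotent[OF False] that unfolding W_def N_def .
    have vW: "v \<in> W" using v by (simp add: W_def)
    show ?thesis
    proof (cases "W \<subseteq> Ker N W 2")
      case True
      then have sq: "N \<star> N \<star> w = 0" if "w \<in> W" for w
        using that by (auto simp: Ker_def[OF W NW nil] power2_eq_square)
      have au: "a * u = u * a" by (rule u[OF ta[symmetric], symmetric])
      have ub: "u * b = b * a * u" by (rule u[OF tb])
      then have Nb: "N * b = b * ((1 + N) * (1 + (a - 1)) - 1)"
        by (simp add: N left_diff_distrib right_diff_distrib mult.assoc au)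
      have uc: "u * c = c * a * a * u" by (rule u[OF tc])
      have "a * (a * u) = u * (a * a)" unfolding au by (simp only: mult.assoc[symmetric] au)
      with uc have Nc: "N * c = c * ((1 + N) * (1 + (a - 1)) * (1 + (a - 1)) - 1)"
        by (simp add: N left_diff_distrib right_diff_distrib mult.assoc)
      have Na: "N * (a - 1) = (a - 1) * N" "N * (y - 1) = (y - 1) * N"
        using comm[OF ta] comm[OF ty] by (simp_all add: algebra_simps)
      have Wa1: "(a - 1) \<star> w \<in> W" and Wy1: "(y - 1) \<star> w \<in> W" if "w \<in> W" for w
        using vec.subspace_diff[OF W WZ[OF ta that] that] vec.subspace_diff[OF W WZ[OF ty that] that]
        by simp_all
      have kill: "(a * y - y * a) \<star> w = 0" if "w \<in> W" for w
      proof -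
        have "Z \<star> x \<in> W" if "Z \<in> {N, a - 1, y - 1, b, bi, c, ci}" "x \<in> W" for Z x
          using that(1) NW[OF that(2)] Wa1[OF that(2)] Wy1[OF that(2)] Wb[OF that(2)]
            Wbi[OF that(2)] Wc[OF that(2)] Wci[OF that(2)] by (elim insertE emptyE) simp_all
        note square_zero_case[OF W dimW two Na b c this sq Nb Nc \<open>y - 1 = b * (a - 1) * bi\<close> that]
        moreover have "a * y - y * a = (a - 1) * (y - 1) - (y - 1) * (a - 1)" by (simp add: algebra_simps)
        then have "(a * y - y * a) \<star> w = (a - 1) \<star> (y - 1) \<star> w - (y - 1) \<star> (a - 1) \<star> w"
          by (simp only: ap_simps(3,5))
        ultimately show ?thesis by simp
      qed
      have g1: "?g1 \<star> w = 0" if "w \<in> W" for w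
        using kill[OF WZ[OF tai WZ[OF tyi that]]] by (simp only: ap_simps(3))
      \<comment> \<open>\<open>?g1\<close> vanishes on \<open>W\<close> only, so
        \<open>?g2 \<star> v\<close> has to be placed in \<open>W\<close> first.\<close>
      have "(X * Y) * t = t * (X * Y)" "(X - Y) * t = t * (X - Y)"
        if "X * t = t * X" "Y * t = t * Y" for X Y
        using that by (metis mult.assoc, simp add: left_diff_distrib right_diff_distrib)
      then have "?g2 * t = t * ?g2" using ta ty tai tyi by simp
      then have "?g2 \<star> v \<in> W" using vW by (rule WZ)
      then show ?thesis unfolding ap_simps(3)[of ?g1 ?g2] ap_simps(3)[of ?g2 ?g1]
        by (simp only: g1 vW ap_lin(4))
    next
      case False
      have "\<And>Z. Z \<in> {a, y, ai, yi} \<Longrightarrow> N * Z = Z * N"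
        "\<And>Z w. Z \<in> {a, y, ai, yi} \<Longrightarrow> w \<in> W \<Longrightarrow> Z \<star> w \<in> W"
        "\<And>Z. Z \<in> {a, y, ai, yi} \<Longrightarrow> (Z - 1) ^ k = 0"
        using comm WZ ta ty tai tyi unip unipi unipy unipyi by blast+
      from commutators_of_centralizer[OF W NW nil dimW False this vW]
      show ?thesis by blast
    qed
  qed
  have 1: "a * y * ai * yi = 1 + ?g1" "ai * y * a * yi = 1 + ?g2"
    using yyi by (simp_all add: left_diff_distrib mult.assoc aai a)
  have "?g1 * ?g2 = ?g2 * ?g1"
    by (rule endo_eq_on_gen[of t]) (simp only: zero)
  then show ?thesis unfolding 1 by (simp only: distrib_left distrib_right mult_1_left mult_1_right ac_simps)
qed

subsection \<open>Additive characters of the multiplicative group\<close>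

lemma powi_prod_point:
  fixes u :: "'a::field"
  assumes "finite S" "u \<in> S"
  shows "(\<Prod>w\<in>S. w powi (if w = u then k else 0)) = u powi k"
proof -
  have "(\<Prod>w\<in>S. w powi (if w = u then k else 0)) = (\<Prod>w\<in>S. if w = u then w powi k else 1)"
    by (rule prod.cong) auto
  then show ?thesis using assms by simp
qed

lemma powi_prod: "(\<Prod>w\<in>S. f w powi k) = (\<Prod>w\<in>S. f w :: 'a::field) powi k"
  by (induction S rule: infinite_finite_induct) (simp_all add: power_int_mult_distrib)

text \<open>Tensored with the rationals, the multiplicative group becomes a rational vector space in
  which only roots of unity vanish; a linear functional nonzero at \<open>x\<close> is the desired
  character.\<close>

lemma additive_character_exists:
  fixes x :: "'a::field"
  assumes x: "x \<noteq> 0" "\<And>n. n > 0 \<Longrightarrow> x ^ n \<noteq> 1"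
  shows "\<exists>\<phi> :: 'a \<Rightarrow> rat. (\<forall>y z. y \<noteq> 0 \<longrightarrow> z \<noteq> 0 \<longrightarrow> \<phi> (y * z) = \<phi> y + \<phi> z) \<and> \<phi> x \<noteq> 0"
proof -
  define scale :: "rat \<Rightarrow> ('a \<Rightarrow> rat) \<Rightarrow> 'a \<Rightarrow> rat" where "scale c f = (\<lambda>y. c * f y)" for c f
  interpret vs: vector_space scale
    by unfold_locales (auto simp: scale_def fun_eq_iff algebra_simps)
  interpret vp: vector_space_pair scale "(*) :: rat \<Rightarrow> rat \<Rightarrow> rat" ..
  define E :: "'a \<Rightarrow> 'a \<Rightarrow> rat" where "E y = (\<lambda>w. if w = y then 1 else 0)" for y
  define R where "R = {E (y * z) - E y - E z |y z. y \<noteq> 0 \<and> z \<noteq> 0}"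
  \<comment> \<open>a linear functional on the rational vector space over the symbols \<open>E y\<close> that kills \<open>R\<close> is a
    character; \<open>E x\<close> lies outside the span of \<open>R\<close> because \<open>x\<close> has infinite order\<close>
  have rel: "\<exists>n>0. \<exists>S g. finite S \<and> 0 \<notin> S \<and> (\<forall>w. w \<notin> S \<longrightarrow> g w = 0) \<and>
      (\<forall>w. of_int n * v w = of_int (g w)) \<and> (\<Prod>w\<in>S. w powi g w) = 1"
    if "v \<in> vs.span R" for v
    using that
  proof (induction rule: vs.span_induct_alt)
    case base
    show ?case
      by (rule exI[of _ 1], simp, rule exI[of _ "{}"], simp, rule exI[of _ "\<lambda>_. 0"], simp)
  next
    case (step c r v)
    obtain p q :: int where c: "c = of_int p / of_int q" "q > 0"
      by (metis Rat_cases Fract_of_int_quotient)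
    obtain y z where yz: "y \<noteq> 0" "z \<noteq> 0" and r: "r = E (y * z) - E y - E z"
      using step.hyps by (auto simp: R_def)
    obtain n S g where n: "n > 0" and S: "finite S" "0 \<notin> S" and g: "\<And>w. w \<notin> S \<Longrightarrow> g w = 0"
      and ng: "\<And>w. of_int n * v w = of_int (g w)" and pg: "(\<Prod>w\<in>S. w powi g w) = 1"
      using step.IH by metis
    \<comment> \<open>A sum of point masses, because \<open>y * z\<close>, \<open>y\<close> and
      \<open>z\<close> may coincide.\<close>
    define h :: "'a \<Rightarrow> int" where
      "h w = (if w = y * z then 1 else 0) + (if w = y then -1 else 0) + (if w = z then -1 else 0)" for w
    have rh: "r w = of_int (h w)" for w by (simp add: r E_def h_def)
    define S' where "S' = S \<union> {y * z, y, z}"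
    have S': "finite S'" "0 \<notin> S'" using S yz by (auto simp: S'_def)
    have "(\<Prod>w\<in>S'. w powi h w) = (\<Prod>w\<in>S'. w powi (if w = y * z then 1 else 0)
        * w powi (if w = y then -1 else 0) * w powi (if w = z then -1 else 0))"
    proof (rule prod.cong[OF refl])
      fix w assume "w \<in> S'"
      then have "w \<noteq> 0" using S'(2) by blast
      then show "w powi h w = w powi (if w = y * z then 1 else 0)
        * w powi (if w = y then -1 else 0) * w powi (if w = z then -1 else 0)"
        unfolding h_def by (simp only: power_int_add simp_thms)
    qed
    also have "\<dots> = (y * z) powi 1 * y powi (-1) * z powi (-1)"
      unfolding prod.distrib using S' by (simp add: powi_prod_point S'_def)
    also have "\<dots> = 1" using yz by (simp add: power_int_minus field_simps)
    finally have ph: "(\<Prod>w\<in>S'. w powi h w) = 1" .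
    have "(\<Prod>w\<in>S'. w powi g w) = (\<Prod>w\<in>S. w powi g w)"
      by (rule prod.mono_neutral_right) (use S' g in \<open>auto simp: S'_def\<close>)
    with pg have pg': "(\<Prod>w\<in>S'. w powi g w) = 1" by simp
    \<comment> \<open>Clearing denominators: \<open>n * q\<close> times the new vector is
      \<open>n * p\<close> times \<open>r\<close> plus \<open>q\<close> times the integral vector
      \<open>g\<close>, and both products over \<open>S'\<close> are 1.\<close>
    have "(\<Prod>w\<in>S'. w powi (n * p * h w + q * g w))
       = (\<Prod>w\<in>S'. (w powi h w) powi (n * p) * (w powi g w) powi q)"
    proof (rule prod.cong[OF refl])
      fix w assume "w \<in> S'"
      then have "w \<noteq> 0" using S'(2) by blast
      then have "w powi (n * p * h w + q * g w) = w powi (h w * (n * p)) * w powi (g w * q)"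
        by (simp only: power_int_add simp_thms mult.commute)
      then show "w powi (n * p * h w + q * g w) = (w powi h w) powi (n * p) * (w powi g w) powi q"
        by (simp only: power_int_mult)
    qed
    also have "\<dots> = (\<Prod>w\<in>S'. w powi h w) powi (n * p) * (\<Prod>w\<in>S'. w powi g w) powi q"
      by (simp add: prod.distrib powi_prod)
    also have "\<dots> = 1" unfolding ph pg' by simp
    finally have "(\<Prod>w\<in>S'. w powi (n * p * h w + q * g w)) = 1" .
    moreover have "of_int (n * q) * (scale c r + v) w = of_int (n * p * h w + q * g w)" for w
    proof -
      have "of_int (n * q) * (scale c r + v) w = of_int (n * p) * r w + of_int q * (of_int n * v w)"
        using c(2) unfolding scale_def c(1) plus_fun_apply by (simp add: distrib_left)
      then show ?thesis unfolding ng rh by simp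
    qed
    moreover have "n * p * h w + q * g w = 0" if "w \<notin> S'" for w
      using that g by (auto simp: h_def S'_def)
    moreover have "n * q > 0" using n c(2) by simp
    ultimately show ?case using S'
      by (intro exI[of _ "n * q"] conjI exI[of _ S'] exI[of _ "\<lambda>w. n * p * h w + q * g w"] allI impI)
  qed
  \<comment> \<open>For \<open>E x\<close> the relation \<open>rel\<close> would read
    \<open>x ^ n = 1\<close> with \<open>n\<close> positive.\<close>
  have Ex: "E x \<notin> vs.span R"
  proof
    assume "E x \<in> vs.span R"
    then obtain n S g where n: "n > 0" and S: "finite S" "0 \<notin> S" and g: "\<And>w. w \<notin> S \<Longrightarrow> g w = 0"
      and ng: "\<And>w. of_int n * E x w = of_int (g w)" and pg: "(\<Prod>w\<in>S. w powi g w) = 1"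
      using rel by metis
    have gw: "g w = (if w = x then n else 0)" for w
      using ng[of w] unfolding E_def by (cases "w = x") simp_all
    have "x \<in> S" using g[of x] gw[of x] n by auto
    then have "x powi n = 1" using pg powi_prod_point[OF S(1), of x n] unfolding gw by simp
    then have "x ^ nat n = 1" using n by (simp add: power_int_def)
    with x(2)[of "nat n"] n show False by simp
  qed
  obtain B where B: "B \<subseteq> R" "vs.independent B" "R \<subseteq> vs.span B"
    using vs.maximal_independent_subset by metis
  have "vs.span R = vs.span B"
    using B by (metis vs.span_mono vs.span_span subset_antisym)
  then have "E x \<notin> vs.span B" using Ex by simp
  then have "vs.independent (insert (E x) B)" using B(2) by (simp add: vs.independent_insert)
  then obtain f where f: "Vector_Spaces.linear scale (*) f"
    and fB: "\<forall>w\<in>insert (E x) B. f w = (if w = E x then 1 else 0)"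
    using vp.linear_independent_extend[of "insert (E x) B" "\<lambda>w. if w = E x then 1 else 0"] by blast
  have "E x \<notin> B" using \<open>E x \<notin> vs.span B\<close> vs.span_base by blast
  have f0: "f w = 0" if "w \<in> vs.span B" for w
    by (rule vp.linear_eq_0_on_span[OF f _ that]) (use fB \<open>E x \<notin> B\<close> in auto)
  have "f (E (y * z)) = f (E y) + f (E z)" if "y \<noteq> 0" "z \<noteq> 0" for y z
  proof -
    have "f (E (y * z) - E y - E z) = 0" using that B(3) by (intro f0) (auto simp: R_def)
    then show ?thesis by (simp add: vp.linear_diff[OF f])
  qed
  moreover have "f (E x) \<noteq> 0" using fB by simp
  ultimately show ?thesis by (intro exI[of _ "\<lambda>y. f (E y)"]) blast
qed

subsection \<open>Simultaneous triangularisation\<close>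

text \<open>Upper triangular shape along \<open>v 0, ..., v (n - 1)\<close> with diagonal entries
  \<open>\<mu> i\<close>.\<close>

definition triangular ::
  "('a::field, 'n::finite) endo \<Rightarrow> (nat \<Rightarrow> 'a ^ 'n) \<Rightarrow> (nat \<Rightarrow> 'a) \<Rightarrow> nat \<Rightarrow> bool" where
  "triangular X v \<mu> n \<longleftrightarrow> (\<forall>i<n. (X - scal (\<mu> i)) \<star> v i \<in> vec.span (v ` {..<i}))"

lemma span_initial_mono: "(i::nat) \<le> j \<Longrightarrow> vec.span (v ` {..<i}) \<subseteq> vec.span (v ` {..<j})"
  by (intro vec.span_mono image_mono) auto

lemma triangular_invariant:
  assumes "triangular X v \<mu> n" "i \<le> n" "u \<in> vec.span (v ` {..<i})"
  shows "X \<star> u \<in> vec.span (v ` {..<i})"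
  using assms(3)
proof (induction rule: vec.span_induct_alt)
  case base
  show ?case by (simp add: vec.span_zero)
next
  case (step c x y)
  then obtain j where j: "j < i" "x = v j" by auto
  have "(X - scal (\<mu> j)) \<star> v j \<in> vec.span (v ` {..<i})"
    using assms(1,2) j(1) span_initial_mono[of j i v] unfolding triangular_def by auto
  moreover have "\<mu> j *s v j \<in> vec.span (v ` {..<i})"
    using j by (intro vec.span_scale vec.span_base) auto
  ultimately have "(X - scal (\<mu> j)) \<star> v j + \<mu> j *s v j \<in> vec.span (v ` {..<i})" by (rule vec.span_add)
  then have "X \<star> x \<in> vec.span (v ` {..<i})" using j by simp
  then show ?case using step.IH by (simp add: vec.span_add vec.span_scale)
qed

lemma triangular_mult:
  assumes X: "triangular X v \<mu> n" and Y: "triangular Y v \<nu> n"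
  shows "triangular (X * Y) v (\<lambda>i. \<mu> i * \<nu> i) n"
  unfolding triangular_def
proof (intro allI impI)
  fix i assume i: "i < n"
  have "X \<star> (Y - scal (\<nu> i)) \<star> v i \<in> vec.span (v ` {..<i})"
    using Y i by (intro triangular_invariant[OF X less_imp_le[OF i]]) (auto simp: triangular_def)
  moreover have "\<nu> i *s ((X - scal (\<mu> i)) \<star> v i) \<in> vec.span (v ` {..<i})"
    using X i by (intro vec.span_scale) (auto simp: triangular_def)
  ultimately have "X \<star> (Y - scal (\<nu> i)) \<star> v i + \<nu> i *s ((X - scal (\<mu> i)) \<star> v i)
      \<in> vec.span (v ` {..<i})" by (rule vec.span_add)
  then show "(X * Y - scal (\<mu> i * \<nu> i)) \<star> v i \<in> vec.span (v ` {..<i})"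
    by (simp add: vector_ssub_ldistrib vector_smult_assoc mult.commute)
qed

lemma triangular_one: "triangular 1 v (\<lambda>i. 1) n"
  by (simp add: triangular_def vec.span_zero)

lemma triangular_power: "triangular X v \<mu> n \<Longrightarrow> triangular (X ^ k) v (\<lambda>i. \<mu> i ^ k) n"
  by (induction k) (use triangular_mult triangular_one in fastforce)+

text \<open>Each factor \<open>X - 1\<close> moves down one step in the flag of initial
  spans.\<close>

lemma triangular_unipotent:
  fixes X :: "('a::field, 'n::finite) endo"
  assumes X: "triangular X v (\<lambda>i. 1) n" and full: "vec.span (v ` {..<n}) = UNIV"
  shows "(X - 1) ^ n = 0"
proof -
  have step: "(X - 1) \<star> u \<in> vec.span (v ` {..<i})" if "i < n" "u \<in> vec.span (v ` {..<Suc i})" for i u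
    using that(2)
  proof (induction rule: vec.span_induct_alt)
    case base
    show ?case by (simp add: vec.span_zero)
  next
    case (step c x y)
    then obtain j where j: "j \<le> i" "x = v j" by (auto simp: less_Suc_eq_le)
    have "scal 1 = (1 :: ('a, 'n) endo)" by (rule endo_eqI) simp
    then have "(X - 1) \<star> x \<in> vec.span (v ` {..<j})"
      using X j that(1) by (auto simp: triangular_def)
    then have "c *s ((X - 1) \<star> x) + (X - 1) \<star> y \<in> vec.span (v ` {..<i})"
      using span_initial_mono[OF j(1), of v] step.IH by (intro vec.span_add vec.span_scale) auto
    then show ?case by (simp only: ap_lin)
  qed
  have "((X - 1) ^ k) \<star> u = 0" if "k \<le> n" "u \<in> vec.span (v ` {..<k})" for k u
    using that
  proof (induction k arbitrary: u)
    case (Suc k)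
    then have "((X - 1) ^ k) \<star> (X - 1) \<star> u = 0" by (intro Suc.IH step) simp_all
    then show ?case by (simp only: power_Suc2 ap_simps(3))
  qed simp
  then have "((X - 1) ^ n) \<star> u = 0" for u using full by blast
  then show ?thesis by (intro endo_eqI) simp
qed

text \<open>Linear independence in a form suited to adjoining one vector at a time.\<close>

definition ascending :: "(nat \<Rightarrow> 'a::field ^ 'n::finite) \<Rightarrow> nat \<Rightarrow> bool" where
  "ascending v n \<longleftrightarrow> (\<forall>i<n. v i \<notin> vec.span (v ` {..<i}))"

lemma ascending_independent:
  "ascending v n \<Longrightarrow> vec.independent (v ` {..<n}) \<and> card (v ` {..<n}) = n"
proof (induction n)
  case 0
  show ?case by (simp add: vec.independent_empty)
next
  case (Suc n)
  then have IH: "vec.independent (v ` {..<n})" "card (v ` {..<n}) = n"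
    and n: "v n \<notin> vec.span (v ` {..<n})" by (auto simp: ascending_def)
  have "v n \<notin> v ` {..<n}" using n by (meson vec.span_base)
  then show ?case using IH n by (simp add: lessThan_Suc vec.independent_insert)
qed

text \<open>The basis grows by a common eigenvector modulo the span reached so far, which is
  invariant because \<open>T\<close> is already triangular on it.\<close>

lemma common_triangular_basis:
  fixes S T :: "('a::alg_closed_field, 'n::finite) endo"
  assumes "S * T = T * S"
  obtains v \<alpha> \<tau> where "ascending v (CARD('n))" "vec.span (v ` {..<CARD('n)}) = UNIV"
    "triangular S v \<alpha> (CARD('n))" "triangular T v \<tau> (CARD('n))"
proof -
  have "k \<le> CARD('n) \<Longrightarrow> \<exists>v \<alpha> \<tau>. ascending v k \<and> triangular S v \<alpha> k \<and> triangular T v \<tau> k" for k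
  proof (induction k)
    case 0
    show ?case by (simp add: ascending_def triangular_def)
  next
    case (Suc k)
    then obtain v \<alpha> \<tau> where v: "ascending v k" "triangular S v \<alpha> k" "triangular T v \<tau> k" by auto
    let ?U = "vec.span (v ` {..<k})"
    have "vec.dim ?U = k" using ascending_independent[OF v(1)] by (simp add: vec.dim_eq_card_independent)
    moreover have "vec.dim (UNIV :: ('a ^ 'n) set) = CARD('n)" by (rule vec_dim_card)
    ultimately have "?U \<noteq> UNIV" using Suc.prems by (metis Suc_n_not_le_n)
    from common_eigenvector_mod[OF vec.subspace_span this assms triangular_invariant[OF v(3) order_refl]]
    obtain w r s where w: "w \<notin> ?U" "(S - scal r) \<star> w \<in> ?U" "(T - scal s) \<star> w \<in> ?U" by blast
    define v' where "v' = v(k := w)"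
    have v': "v' k = w" "\<And>i. i < k \<Longrightarrow> v' i = v i" by (simp_all add: v'_def)
    have im: "v' ` {..<i} = v ` {..<i}" if "i \<le> k" for i
      using that v'(2) by (intro image_cong) auto
    show ?case
    proof (intro exI conjI)
      show "ascending v' (Suc k)"
        using v(1) w(1) by (auto simp: ascending_def less_Suc_eq im v')
      show "triangular S v' (\<alpha>(k := r)) (Suc k)"
        using v(2) w(2) by (auto simp: triangular_def less_Suc_eq im v')
      show "triangular T v' (\<tau>(k := s)) (Suc k)"
        using v(3) w(3) by (auto simp: triangular_def less_Suc_eq im v')
    qed
  qed
  from this[OF order_refl] obtain v \<alpha> \<tau> where v: "ascending v (CARD('n))"
    "triangular S v \<alpha> (CARD('n))" "triangular T v \<tau> (CARD('n))" by blast
  have "vec.span (v ` {..<CARD('n)}) = UNIV"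
  proof -
    have "vec.dim (UNIV :: ('a ^ 'n) set) \<le> card (v ` {..<CARD('n)})"
      unfolding vec_dim_card using ascending_independent[OF v(1)] by simp
    with ascending_independent[OF v(1)] have "UNIV \<subseteq> vec.span (v ` {..<CARD('n)})"
      by (intro vec.card_ge_dim_independent) simp_all
    then show ?thesis by blast
  qed
  with v show ?thesis using that by blast
qed

subsection \<open>Characteristic polynomials\<close>

text \<open>The matrix of \<open>X\<close> with its entries read as constant polynomials, so that
  the indeterminate minus \<open>X\<close> has a determinant.\<close>

definition pmat :: "('a::field, 'n::finite) endo \<Rightarrow> 'a poly ^ 'n ^ 'n" where
  "pmat X = (\<chi> i j. [:(X \<star> axis j 1) $ i:])"

definition char_pol :: "('a::field, 'n::finite) endo \<Rightarrow> 'a poly" where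
  "char_pol X = det (mat [:0, 1:] - pmat X)"

lemma ap_axis: "X \<star> w = (\<Sum>j\<in>UNIV. w $ j *s (X \<star> axis j 1))"
proof -
  have "w = (\<Sum>j\<in>UNIV. w $ j *s axis j 1)" by (simp add: basis_expansion)
  then have "X \<star> w = X \<star> (\<Sum>j\<in>UNIV. w $ j *s axis j 1)" by simp
  also have "\<dots> = (\<Sum>j\<in>UNIV. X \<star> (w $ j *s axis j 1))" by (rule vec.linear_sum[OF linear_ap])
  finally show ?thesis by simp
qed

lemma pmat_mult: "pmat (X * Y) = pmat X ** pmat Y"
proof -
  have sum: "[:(\<Sum>k\<in>A. g k):] = (\<Sum>k\<in>A. [:g k:])" for A and g :: "'b \<Rightarrow> 'a"
    by (rule poly_eqI) (simp add: coeff_sum coeff_pCons split: nat.split)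
  show ?thesis
    by (simp add: vec_eq_iff pmat_def matrix_matrix_mult_def ap_axis[of X "Y \<star> _"] sum_component
        sum mult.commute)
qed

lemma pmat_one: "pmat 1 = mat 1"
  by (simp add: vec_eq_iff pmat_def mat_def axis_def one_pCons)

text \<open>The scalar matrix of the indeterminate commutes with all matrices, so conjugation can be
  pulled out of the difference, and the determinants of \<open>Q\<close> and \<open>P\<close>
  cancel.\<close>

lemma char_pol_conj:
  assumes "Q * P = 1" shows "char_pol (Q * X * P) = char_pol X"
proof -
  let ?x = "mat [:0, 1:] :: 'a poly ^ 'b ^ 'b"
  have PQ: "pmat Q ** pmat P = mat 1" using assms by (metis pmat_mult pmat_one)
  have xP: "?x ** A = A ** ?x" for A
    by (simp add: vec_eq_iff matrix_matrix_mult_def mat_def if_distrib if_distribR mult.commute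
        sum.delta sum.delta' cong: if_cong)
  have "?x - pmat (Q * X * P) = pmat Q ** (?x - pmat X) ** pmat P"
  proof -
    have "pmat Q ** (?x - pmat X) = pmat Q ** ?x - pmat Q ** pmat X"
      by (simp add: vec_eq_iff matrix_matrix_mult_def right_diff_distrib sum_subtractf)
    then have "pmat Q ** (?x - pmat X) ** pmat P = pmat Q ** ?x ** pmat P - pmat Q ** pmat X ** pmat P"
      by (simp add: vec_eq_iff matrix_matrix_mult_def left_diff_distrib sum_subtractf)
    also have "pmat Q ** ?x ** pmat P = ?x"
      unfolding xP[symmetric] by (simp add: PQ flip: matrix_mul_assoc)
    finally show ?thesis by (simp add: pmat_mult)
  qed
  then have "char_pol (Q * X * P) = det (pmat Q) * char_pol X * det (pmat P)"
    by (simp add: char_pol_def det_mul)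
  also have "\<dots> = det (pmat Q ** pmat P) * char_pol X" by (simp add: det_mul)
  finally show ?thesis by (simp add: PQ)
qed

lemma char_pol_triangular:
  fixes X :: "('a::field, 'n::{finite,wellorder}) endo"
  assumes asc: "ascending v (CARD('n))" and full: "vec.span (v ` {..<CARD('n)}) = UNIV"
    and X: "triangular X v \<mu> (CARD('n))"
  shows "char_pol X = (\<Prod>i<CARD('n). [:- \<mu> i, 1:])"
proof -
  \<comment> \<open>The order isomorphism from the index type onto \<open>{..<CARD('n)}\<close>; it
    turns triangularity along \<open>v\<close> into triangularity of a matrix indexed by
    \<open>'n\<close>.\<close>
  define idx where "idx i = card {..<i}" for i :: 'n
  have idx_less: "idx i < idx j \<longleftrightarrow> i < j" for i j
  proof -
    have mono: "idx i < idx j" if "i < j" for i j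
      unfolding idx_def by (rule psubset_card_mono) (use that in auto)
    show ?thesis using mono[of i j] mono[of j i] by (metis linorder_less_linear order_less_asym)
  qed
  have idx_lt: "idx i < CARD('n)" for i
    unfolding idx_def by (rule psubset_card_mono) auto
  have inj: "inj idx"
    using idx_less by (metis injI linorder_less_linear order_less_irrefl)
  have "idx ` UNIV = {..<CARD('n)}"
    using idx_lt by (intro card_subset_eq) (auto simp: card_image[OF inj])
  then have bij: "bij_betw idx UNIV {..<CARD('n)}" using inj by (simp add: bij_betw_def)
  \<comment> \<open>\<open>P\<close> sends the standard basis to \<open>v\<close>, and its inverse
    \<open>Q\<close> will bring \<open>X\<close> into triangular form.\<close>
  define P where "P = Endo ((*v) (\<chi> i j. v (idx j) $ i))"
  have P: "P \<star> w = (\<chi> i j. v (idx j) $ i) *v w" for w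
    unfolding P_def by (subst Endo_inverse) (auto simp: matrix_vector_mul_linear_gen)
  have Pax: "P \<star> axis j 1 = v (idx j)" for j
    by (simp add: P vec_eq_iff matrix_vector_mult_def axis_def if_distrib cong: if_cong)
  have surj: "surj (ap P)"
  proof -
    have "v ` {..<CARD('n)} \<subseteq> range (ap P)"
    proof
      fix x assume "x \<in> v ` {..<CARD('n)}"
      then obtain k where k: "k \<in> {..<CARD('n)}" "x = v k" by auto
      from k(1) obtain j where "k = idx j" unfolding \<open>idx ` UNIV = _\<close>[symmetric] by (rule imageE)
      with k(2) have "x = v (idx j)" by simp
      then show "x \<in> range (ap P)" using Pax[of j] by (metis rangeI)
    qed
    then have "vec.span (v ` {..<CARD('n)}) \<subseteq> range (ap P)"
      using vec.linear_subspace_image[OF linear_ap vec.subspace_UNIV] by (intro vec.span_minimal)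
    then show ?thesis using full by blast
  qed
  then obtain g where g: "Vector_Spaces.linear (*s) (*s) g" "ap P \<circ> g = id"
    using vec.linear_surjective_right_inverse[OF linear_ap] by blast
  then have gP: "g \<circ> ap P = id" using vec.linear_inverse_left[OF linear_ap g(1)] by blast
  define Q where "Q = Endo g"
  have Q: "Q \<star> w = g w" for w unfolding Q_def by (subst Endo_inverse) (simp_all add: g)
  have QPw: "Q \<star> P \<star> w = w" for w using gP by (simp add: Q fun_eq_iff)
  then have QP: "Q * P = 1" by (intro endo_eqI) simp
  have Qv: "Q \<star> v (idx j) = axis j 1" for j using QPw[of "axis j 1"] by (simp add: Pax)
  have low: "(Q \<star> u) $ i = 0" if "u \<in> vec.span (v ` {..<idx j})" "j \<le> i" for u i j
    using that(1)
  proof (induction rule: vec.span_induct_alt)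
    case (step c x y)
    then obtain k where k: "k < idx j" "x = v k" by auto
    then obtain l where l: "k = idx l"
      using \<open>idx ` UNIV = _\<close> idx_lt[of j] by (metis imageE lessThan_iff order_less_trans)
    then have "l < j" using k idx_less by simp
    then show ?case using step.IH that(2) unfolding k l by (simp add: Qv axis_def)
  qed simp
  have ent: "((Q * X * P) \<star> axis j 1) $ i = (if i = j then \<mu> (idx j) else 0)" if "j \<le> i" for i j
  proof -
    have "(X - scal (\<mu> (idx j))) \<star> v (idx j) \<in> vec.span (v ` {..<idx j})"
      using X idx_lt by (simp add: triangular_def)
    from low[OF this that] have "(Q \<star> X \<star> v (idx j)) $ i = (if i = j then \<mu> (idx j) else 0)"
      by (simp add: Qv axis_def split: if_splits)
    then show ?thesis by (simp only: ap_simps(3) Pax)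
  qed
  have "char_pol X = char_pol (Q * X * P)" using char_pol_conj[OF QP] by simp
  also have "\<dots> = (\<Prod>i\<in>UNIV. (mat [:0, 1:] - pmat (Q * X * P)) $ i $ i)"
    unfolding char_pol_def
  proof (rule det_upperdiagonal)
    fix i j :: 'n assume "j < i"
    then show "(mat [:0, 1:] - pmat (Q * X * P)) $ i $ j = 0"
      using ent[of j i] by (simp add: pmat_def mat_def del: ap_simps)
  qed
  also have "\<dots> = (\<Prod>i\<in>UNIV. [:- \<mu> (idx i), 1:])"
    using ent by (intro prod.cong) (simp_all add: pmat_def mat_def del: ap_simps)
  also have "\<dots> = (\<Prod>i<CARD('n). [:- \<mu> i, 1:])" by (rule prod.reindex_bij_betw[OF bij])
  finally show ?thesis .
qed

text \<open>Shows that a sum over the diagonal entries depends on the characteristic polynomial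
  alone, hence agrees for conjugate operators.\<close>

lemma sum_eigenvalues:
  fixes \<mu> :: "nat \<Rightarrow> 'a::field"
  shows "(\<Sum>x\<in>#proots (\<Prod>i<n. [:- \<mu> i, 1:]). F x) = (\<Sum>i<n. F (\<mu> i))"
proof (induction n)
  case (Suc n)
  have "(\<Prod>i<n. [:- \<mu> i, 1:]) \<noteq> 0" by auto
  then show ?case using Suc by (subst prod.lessThan_Suc, subst proots_mult) (auto simp: add.commute)
qed simp

text \<open>Otherwise \<open>X\<close> maps \<open>v i\<close> into the span of its predecessors.
  The inverse preserves this span too, which would then contain \<open>v i\<close>.\<close>

lemma eigenvalue_nonzero:
  assumes asc: "ascending v n" and X: "triangular X v \<mu> n" and inv: "Y * X = 1" and i: "i < n"
  shows "\<mu> i \<noteq> 0"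
proof
  assume "\<mu> i = 0"
  then have "X \<star> v i \<in> vec.span (v ` {..<i})" using X i by (auto simp: triangular_def)
  moreover have "X \<star> u \<in> vec.span (v ` {..<i})" if "u \<in> vec.span (v ` {..<i})" for u
    by (rule triangular_invariant[OF X less_imp_le[OF i] that])
  ultimately have "Y \<star> X \<star> v i \<in> vec.span (v ` {..<i})"
    using inverse_invariant[OF inv vec.subspace_span] by blast
  then have "v i \<in> vec.span (v ` {..<i})" using inv by (metis ap_simps(2,3))
  then show False using asc i by (simp add: ascending_def)
qed

lemma power_unipotent:
  fixes a ai b bi c ci t ti :: "('a::alg_closed_field, 'n::{finite,wellorder}) endo"
  assumes a: "ai * a = 1" and b: "bi * b = 1" and c: "ci * c = 1" and t: "ti * t = 1"
    and ta: "a * t = t * a" and tb: "t * b = b * a * t" and tc: "t * c = c * a * a * t"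
  obtains m where "m > 0" "(a ^ m - 1) ^ CARD('n) = 0"
proof -
  let ?n = "CARD('n)"
  obtain v \<alpha> \<tau> where asc: "ascending v ?n" and full: "vec.span (v ` {..<?n}) = UNIV"
    and A: "triangular a v \<alpha> ?n" and T: "triangular t v \<tau> ?n"
    using common_triangular_basis[OF ta] by metis
  have nz: "\<alpha> i \<noteq> 0" "\<tau> i \<noteq> 0" if "i < ?n" for i
    using eigenvalue_nonzero[OF asc A a that] eigenvalue_nonzero[OF asc T t that] .
  have conj: "a * t = bi * t * b" "a * a * t = ci * t * c"
    using b c by (simp_all add: mult.assoc tb tc) (simp_all flip: mult.assoc)
  have cp: "char_pol (a * t) = char_pol t" "char_pol (a * a * t) = char_pol t"
    unfolding conj using char_pol_conj[OF b] char_pol_conj[OF c] .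
  note cpt = char_pol_triangular[OF asc full]
  have sums: "(\<Sum>i<?n. F (\<alpha> i * \<tau> i)) = (\<Sum>i<?n. F (\<tau> i))"
    "(\<Sum>i<?n. F (\<alpha> i * \<alpha> i * \<tau> i)) = (\<Sum>i<?n. F (\<tau> i))" for F :: "'a \<Rightarrow> rat"
    using cp cpt[OF T] cpt[OF triangular_mult[OF A T]]
      cpt[OF triangular_mult[OF triangular_mult[OF A A] T]] sum_eigenvalues[of F _ ?n] by metis+
  have "\<exists>m>0. \<alpha> i ^ m = 1" if i: "i < ?n" for i
  proof (rule ccontr)
    assume "\<not> ?thesis"
    then obtain \<phi> :: "'a \<Rightarrow> rat" where
      \<phi>: "\<And>y z. y \<noteq> 0 \<Longrightarrow> z \<noteq> 0 \<Longrightarrow> \<phi> (y * z) = \<phi> y + \<phi> z" and ni: "\<phi> (\<alpha> i) \<noteq> 0"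
      using additive_character_exists[OF nz(1)[OF i]] by blast
    \<comment> \<open>The identity \<open>(2x + z)^2 - 2 (x + z)^2 + z^2 = 2 x^2\<close>, summed
      over the joint eigenvalues. The three sums on the right agree because the operators are
      conjugate, and a vanishing sum of rational squares has only zero terms.\<close>
    have "2 * (\<Sum>j<?n. (\<phi> (\<alpha> j))\<^sup>2) = (\<Sum>j<?n. (\<phi> (\<alpha> j * \<alpha> j * \<tau> j))\<^sup>2)
        - 2 * (\<Sum>j<?n. (\<phi> (\<alpha> j * \<tau> j))\<^sup>2) + (\<Sum>j<?n. (\<phi> (\<tau> j))\<^sup>2)"
      unfolding sum_distrib_left sum.distrib[symmetric] sum_subtractf[symmetric]
      by (rule sum.cong) (auto simp: \<phi> nz power2_eq_square algebra_simps)
    also have "\<dots> = 0"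
      using sums[of "\<lambda>x. (\<phi> x)\<^sup>2"] by simp
    finally have "(\<phi> (\<alpha> i))\<^sup>2 = 0" using i by (simp add: sum_nonneg_eq_0_iff)
    with ni show False by simp
  qed
  then obtain m where m: "\<And>i. i < ?n \<Longrightarrow> m i > 0 \<and> \<alpha> i ^ m i = 1" by metis
  define M where "M = (\<Prod>i<?n. m i)"
  have "M > 0" unfolding M_def using m by (intro prod_pos) auto
  have "\<alpha> i ^ M = 1" if "i < ?n" for i
  proof -
    have "m i dvd M" unfolding M_def using that by (intro dvd_prodI) auto
    then show ?thesis using m[OF that] by (metis dvdE power_mult power_one)
  qed
  then have "triangular (a ^ M) v (\<lambda>i. 1) ?n"
    using triangular_power[OF A, of M] by (simp add: triangular_def)
  from triangular_unipotent[OF this full] \<open>M > 0\<close> show ?thesis using that by blast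
qed

section \<open>Reduction to a unipotent power of \<open>a\<close>, and characteristic two\<close>

lemma intertwine_power:
  fixes T :: "'r::monoid_mult"
  assumes "T * b = b * S" shows "T ^ k * b = b * S ^ k"
proof (induction k)
  case (Suc k)
  have "T ^ Suc k * b = T * (b * S ^ k)" by (simp add: Suc mult.assoc)
  also have "\<dots> = T * b * S ^ k" by (simp only: mult.assoc)
  finally show ?case by (simp add: assms mult.assoc)
qed simp

text \<open>Applying Frobenius twice gives \<open>(u - 1)^4 = u^4 - 1\<close>.\<close>

lemma unipotent_char_two:
  fixes u :: "('a::field, 'n::finite) endo"
  assumes two: "(2 :: 'a) = 0" and u: "(u - 1) ^ 4 = 0"
  shows "u ^ 4 = 1"
proof -
  have dbl: "X + X = 0" for X :: "('a, 'n) endo"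
  proof (rule endo_eqI)
    fix v
    have "(1 :: 'a) + 1 = 0" using two by simp
    then have "(1 + 1 :: 'a) *s (X \<star> v) = 0" by (simp only: vector_smult_lzero)
    then show "(X + X) \<star> v = 0 \<star> v"
      by (simp only: ap_simps vector_sadd_rdistrib vector_smult_lid)
  qed
  have sq: "(X - 1)\<^sup>2 = X\<^sup>2 - 1" for X :: "('a, 'n) endo"
  proof -
    have "(X - 1)\<^sup>2 = X\<^sup>2 - 1 - (X + X) + (1 + 1)"
      by (simp add: power2_eq_square left_diff_distrib right_diff_distrib)
    then show ?thesis by (simp only: dbl) simp
  qed
  have "0 = ((u - 1)\<^sup>2)\<^sup>2" using u by (simp flip: power_mult)
  also have "\<dots> = (u\<^sup>2)\<^sup>2 - 1" by (simp only: sq)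
  finally show ?thesis by (simp flip: power_mult)
qed

text \<open>Either alternative is a relation between words that fails in the free group.
  Characteristic two leads to the first and any other characteristic to the second, applied to
  \<open>a ^ m\<close> and \<open>t ^ m\<close> in place of \<open>a\<close> and
  \<open>t\<close>.\<close>

lemma torsion_or_commuting_commutators:
  fixes a ai b bi c ci t ti :: "('a::alg_closed_field, 'n::{finite,wellorder}) endo"
  assumes card: "CARD('n) = 4"
    and a: "a * ai = 1" "ai * a = 1" and b: "b * bi = 1" "bi * b = 1"
    and c: "c * ci = 1" "ci * c = 1" and t: "t * ti = 1" "ti * t = 1"
    and ta: "t * a = a * t" and tb: "t * b = b * a * t" and tc: "t * c = c * a * a * t"
  shows "(\<exists>m>0. a ^ m = 1) \<or> (\<exists>m>0. let x = a ^ m; xi = ai ^ m; y = b * x * bi; yi = b * xi * bi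
    in (x * y * xi * yi) * (xi * y * x * yi) = (xi * y * x * yi) * (x * y * xi * yi))"
proof -
  obtain m where m: "m > 0" "(a ^ m - 1) ^ 4 = 0"
    using power_unipotent[OF a(2) b(2) c(2) t(2) ta[symmetric] tb tc] unfolding card .
  show ?thesis
  proof (cases "(2 :: 'a) = 0")
    case True
    from unipotent_char_two[OF this m(2)] have "a ^ (m * 4) = 1" by (simp only: power_mult)
    then show ?thesis using m(1) by (metis mult_pos_pos zero_less_numeral)
  next
    case False
    have aat: "(a * a) * t = t * (a * a)" by (metis mult.assoc ta)
    have tam: "a ^ m * t ^ m = t ^ m * a ^ m"
      using commute_power[of "a ^ m" t m] commute_power[of t a m] ta by metis
    have "t ^ m * b = b * (a * t) ^ m" by (rule intertwine_power) (simp add: tb mult.assoc)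
    then have tbm: "t ^ m * b = b * a ^ m * t ^ m"
      by (simp add: power_mult_commute[OF ta[symmetric]] mult.assoc)
    have "t ^ m * c = c * (a * a * t) ^ m" by (rule intertwine_power) (simp add: tc mult.assoc)
    then have tcm: "t ^ m * c = c * a ^ m * a ^ m * t ^ m"
      unfolding power_mult_commute[OF aat] power_mult_commute[of a a, OF refl] by (simp only: mult.assoc)
    have "CARD('n) \<le> 4" using card by simp
    note commutators_commute[OF this False left_right_inverse_power[OF a(1)] left_right_inverse_power[OF a(2)]
        b c left_right_inverse_power[OF t(1)] left_right_inverse_power[OF t(2)] tam tbm tcm m(2) refl refl]
    then show ?thesis unfolding Let_def using m(1) by blast
  qed
qed

section \<open>From matrices of size \<open>d\<close> to endomorphisms over the algebraic
  closure\<close>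

text \<open>A matrix is extended by an identity block to the full size and its entries are moved to
  the algebraic closure, so one dimension and algebraically closed fields suffice.\<close>

lemma matrix_embedding:
  assumes d: "d \<le> CARD('n)"
  obtains pad :: "'f::field mat \<Rightarrow> ('f alg_closure, 'n::finite) endo" where
    "\<And>A B. A \<in> carrier_mat d d \<Longrightarrow> B \<in> carrier_mat d d \<Longrightarrow> pad (A * B) = pad A * pad B"
    "pad (1\<^sub>m d) = 1" "inj_on pad (carrier_mat d d)"
proof -
  obtain ix :: "'n \<Rightarrow> nat" where ix: "bij_betw ix UNIV {0..<CARD('n)}"
    using ex_bij_betw_finite_nat[OF finite_class.finite_UNIV] by blast
  have ixeq: "ix i = ix j \<longleftrightarrow> i = j" for i j
    using ix by (metis bij_betw_imp_inj_on UNIV_I inj_on_eq_iff)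
  define E :: "'f mat \<Rightarrow> nat \<Rightarrow> nat \<Rightarrow> 'f alg_closure" where
    "E A r s = (if r < d \<and> s < d then to_ac (A $$ (r, s)) else if r = s then 1 else 0)" for A r s
  define pad :: "'f mat \<Rightarrow> ('f alg_closure, 'n) endo" where
    "pad A = Endo ((*v) (\<chi> i j. E A (ix i) (ix j)))" for A
  have pad: "pad A \<star> w = (\<chi> i j. E A (ix i) (ix j)) *v w" for A w
    unfolding pad_def by (subst Endo_inverse) (auto simp: matrix_vector_mul_linear_gen)
  have E_mult: "(\<Sum>l\<in>{0..<CARD('n)}. E A r l * E B l s) = E (A * B) r s"
    if "A \<in> carrier_mat d d" "B \<in> carrier_mat d d" "r < CARD('n)" for A B r s
  proof (cases "r < d")
    case True
    have "(\<Sum>l\<in>{0..<CARD('n)}. E A r l * E B l s) = (\<Sum>l\<in>{0..<d}. E A r l * E B l s)"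
      by (rule sum.mono_neutral_right) (use d True in \<open>auto simp: E_def\<close>)
    also have "\<dots> = (\<Sum>l\<in>{0..<d}. if s < d then to_ac (A $$ (r, l) * B $$ (l, s)) else 0)"
      by (rule sum.cong) (use True in \<open>auto simp: E_def\<close>)
    also have "\<dots> = E (A * B) r s"
      using True that(1,2) by (auto simp: E_def scalar_prod_def to_ac_sum)
    finally show ?thesis .
  next
    case False
    then have "(\<Sum>l\<in>{0..<CARD('n)}. E A r l * E B l s) = (\<Sum>l\<in>{0..<CARD('n)}. if r = l then E B l s else 0)"
      by (intro sum.cong) (auto simp: E_def)
    also have "\<dots> = E B r s" using that(3) by simp
    finally show ?thesis using False by (simp add: E_def)
  qed
  show ?thesis
  proof (rule that)
    fix A B :: "'f mat" assume AB: "A \<in> carrier_mat d d" "B \<in> carrier_mat d d"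
    have "(\<chi> i j. E (A * B) (ix i) (ix j)) = (\<chi> i j. E A (ix i) (ix j)) ** (\<chi> i j. E B (ix i) (ix j))"
    proof -
      have "E (A * B) (ix i) (ix j) = (\<Sum>k\<in>UNIV. E A (ix i) (ix k) * E B (ix k) (ix j))" for i j
        using E_mult[OF AB, of "ix i" "ix j"] bij_betwE[OF ix] sum.reindex_bij_betw[OF ix, of "\<lambda>l. E A (ix i) l * E B l (ix j)"]
        by simp
      then show ?thesis by (simp add: vec_eq_iff matrix_matrix_mult_def)
    qed
    then show "pad (A * B) = pad A * pad B"
      by (intro endo_eqI) (simp add: pad matrix_vector_mul_assoc)
  next
    have "(\<chi> i j. E (1\<^sub>m d) (ix i) (ix j)) = (Finite_Cartesian_Product.mat 1 :: 'f alg_closure ^ 'n ^ 'n)"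
      by (simp add: vec_eq_iff Finite_Cartesian_Product.mat_def E_def ixeq)
    then show "pad (1\<^sub>m d) = 1" by (intro endo_eqI) (simp add: pad)
  next
    show "inj_on pad (carrier_mat d d)"
    proof (rule inj_onI)
      fix A B :: "'f mat" assume AB: "A \<in> carrier_mat d d" "B \<in> carrier_mat d d" and eq: "pad A = pad B"
      then have "(\<chi> i j. E A (ix i) (ix j)) = (\<chi> i j. E B (ix i) (ix j))"
        by (simp add: matrix_eq flip: pad)
      then have *: "E A (ix i) (ix j) = E B (ix i) (ix j)" for i j by (simp add: vec_eq_iff)
      show "A = B"
      proof (rule eq_matI)
        fix r s assume rs: "r < dim_row B" "s < dim_col B"
        then have rs': "r < d" "s < d" using AB by auto
        then obtain i j where "r = ix i" "s = ix j"
          using d bij_betw_imp_surj_on[OF ix] by (metis atLeast0LessThan imageE lessThan_iff order_less_le_trans)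
        with *[of i j] rs' show "A $$ (r, s) = B $$ (r, s)" by (simp add: E_def)
      qed (use AB in auto)
    qed
  qed
qed

subsection \<open>Reduced words\<close>

lemma normalize_reduced: "reduced w \<Longrightarrow> normalize w = w"
proof (induction w rule: reduced.induct)
  case (3 x y ys)
  then have "normalize (y # ys) = y # ys" by simp
  then have "normalize (x # y # ys) = red_cons x (y # ys)" by (simp add: normalize_def)
  then show ?case using 3 by (simp add: red_cons_def)
qed (simp_all add: normalize_def red_cons_def)

lemma alpha_pow_0: "alpha_pow 0 w = normalize w"
proof -
  have "alpha_letter 0 x = [x]" for x by (cases "(0::int, x)" rule: alpha_letter.cases) (simp_all add: apow_def)
  then have "concat (map (alpha_letter 0) w) = w" by (induction w) simp_all
  then show ?thesis by (simp add: alpha_pow_def)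
qed

lemma reduced_tl: "reduced (x # w) \<Longrightarrow> reduced w"
  by (cases w) simp_all

lemma fmult_letter: "reduced (x # w) \<Longrightarrow> fmult [x] w = x # w"
  using normalize_reduced[of "x # w"] normalize_reduced[OF reduced_tl]
  by (simp add: fmult_def normalize_def)

text \<open>With the next lemma this lets the simplifier verify that words alternating between
  powers of \<open>a\<close> and letters \<open>b\<close> or its inverse are reduced.\<close>

lemma reduced_replicate_Cons:
  "fst z \<noteq> fst l \<Longrightarrow> reduced (replicate m l @ z # ws) \<longleftrightarrow> reduced (z # ws)"
proof (induction m)
  case (Suc m)
  then show ?case by (cases m) (auto simp: inv_letter_def prod_eq_iff)
qed simp

lemma reduced_Cons_replicate:
  "m > 0 \<Longrightarrow> fst z \<noteq> fst l \<Longrightarrow> reduced (z # replicate m l @ ws) \<longleftrightarrow> reduced (replicate m l @ ws)"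
  by (cases m) (auto simp: inv_letter_def)

lemma reduced_replicate: "reduced (replicate m l)"
proof (induction m)
  case (Suc m)
  then show ?case by (cases m) (auto simp: inv_letter_def prod_eq_iff)
qed simp

theorem theorem7p1:
  fixes d :: nat
  assumes "d \<le> 4"
  shows "\<not> (\<exists>h :: letter list \<times> int \<Rightarrow> ('f::field) mat.
             h \<in> hom gersten_group (GL d) \<and> inj_on h (carrier gersten_group))"
proof
  assume "\<exists>h :: letter list \<times> int \<Rightarrow> 'f mat. h \<in> hom gersten_group (GL d) \<and> inj_on h (carrier gersten_group)"
  then obtain h :: "letter list \<times> int \<Rightarrow> 'f mat" where
    h: "h \<in> hom gersten_group (GL d)" "inj_on h (carrier gersten_group)" by blast
  have d: "d \<le> CARD(4)" using assms by simp
  obtain pad :: "'f mat \<Rightarrow> ('f alg_closure, 4) endo" where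
    pad_mult: "\<And>A B. A \<in> carrier_mat d d \<Longrightarrow> B \<in> carrier_mat d d \<Longrightarrow> pad (A * B) = pad A * pad B"
    and pad_one: "pad (1\<^sub>m d) = 1" and pad_inj: "inj_on pad (carrier_mat d d)"
    by (rule matrix_embedding[OF d]) (rule that)
  define \<rho> where "\<rho> w n = pad (h (w, n))" for w n
  have hc: "h (w, n) \<in> carrier_mat d d \<and> invertible_mat (h (w, n))" if "reduced w" for w n
    using hom_in_carrier[OF h(1), of "(w, n)"] that by (simp add: gersten_group_def GL_def)
  have \<rho>_mult: "\<rho> u m * \<rho> v n = \<rho> (fmult u (alpha_pow m v)) (m + n)" if "reduced u" "reduced v" for u v m n
    using hom_mult[OF h(1), of "(u, m)" "(v, n)"] pad_mult hc that
    by (simp add: \<rho>_def gersten_group_def GL_def)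
  have \<rho>_inj: "u = v" if "reduced u" "reduced v" "\<rho> u 0 = \<rho> v 0" for u v
  proof -
    have "h (u, 0) = h (v, 0)" using that hc pad_inj unfolding \<rho>_def by (meson inj_onD)
    with h(2) that show ?thesis by (auto simp: inj_on_def gersten_group_def)
  qed
  \<comment> \<open>Membership in \<open>hom\<close> records multiplicativity only. The image of the
    unit is an idempotent with a right inverse, hence 1.\<close>
  have \<rho>_one: "\<rho> [] 0 = 1"
  proof -
    let ?A = "h ([], 0)"
    have A: "?A \<in> carrier_mat d d" "invertible_mat ?A" using hc[of "[]" 0] by simp_all
    then obtain B where B: "?A * B = 1\<^sub>m d" "B * ?A = 1\<^sub>m (dim_row B)"
      by (auto simp: invertible_mat_def inverts_mat_def)
    have Bc: "B \<in> carrier_mat d d"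
      using A(1) arg_cong[OF B(1), of dim_col] arg_cong[OF B(2), of dim_col] by auto
    have inv: "\<rho> [] 0 * pad B = 1"
      unfolding \<rho>_def pad_mult[OF A(1) Bc, symmetric] B(1) by (rule pad_one)
    have "\<rho> [] 0 * \<rho> [] 0 = \<rho> [] 0"
      using \<rho>_mult[of "[]" "[]" 0 0] by (simp add: fmult_def alpha_pow_def normalize_def)
    then have "\<rho> [] 0 * (\<rho> [] 0 * pad B) = \<rho> [] 0 * pad B" by (simp flip: mult.assoc)
    then show ?thesis by (simp add: inv)
  qed
  define e where "e l = \<rho> [l] 0" for l
  \<comment> \<open>In a reduced word no letter cancels against the next, so multiplying by a letter
    just prefixes it.\<close>
  have word: "\<rho> w 0 = prod_list (map e w)" if "reduced w" for w
    using that
  proof (induction w)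
    case (Cons x w)
    note w = reduced_tl[OF Cons.prems]
    have "\<rho> [x] 0 * \<rho> w 0 = \<rho> (x # w) 0"
      using \<rho>_mult[of "[x]" w 0 0] w fmult_letter[OF Cons.prems]
      by (simp add: alpha_pow_0 normalize_reduced)
    then show ?case using Cons.IH[OF w] by (simp add: e_def)
  qed (simp add: \<rho>_one)
  note defs = fmult_def alpha_pow_def normalize_def red_cons_def inv_letter_def apow_def
  have inv: "e (g, s) * e (g, \<not> s) = 1" for g s
    using \<rho>_mult[of "[(g, s)]" "[(g, \<not> s)]" 0 0] \<rho>_one
    by (simp add: e_def alpha_pow_0) (simp add: defs)
  let ?a = "e (GA, False)" and ?ai = "e (GA, True)" and ?b = "e (GB, False)" and ?bi = "e (GB, True)"
    and ?c = "e (GC, False)" and ?ci = "e (GC, True)" and ?t = "\<rho> [] 1" and ?ti = "\<rho> [] (- 1)"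
  have t: "?t * ?ti = 1" "?ti * ?t = 1"
    using \<rho>_mult[of "[]" "[]" 1 "- 1"] \<rho>_mult[of "[]" "[]" "- 1" 1] \<rho>_one by (simp_all add: defs)
  have wt: "prod_list (map e w) * ?t = \<rho> w 1" if "reduced w" for w
    using \<rho>_mult[of w "[]" 0 1] that word[OF that] normalize_reduced[OF that]
    by (simp add: fmult_def alpha_pow_def normalize_def)
  have ta: "?t * ?a = ?a * ?t"
    using \<rho>_mult[of "[]" "[(GA, False)]" 1 0] wt[of "[(GA, False)]"] by (simp add: e_def defs)
  have tb: "?t * ?b = ?b * ?a * ?t"
    using \<rho>_mult[of "[]" "[(GB, False)]" 1 0] wt[of "[(GB, False), (GA, False)]"]
    by (simp add: e_def defs mult.assoc)
  have tc: "?t * ?c = ?c * ?a * ?a * ?t"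
    using \<rho>_mult[of "[]" "[(GC, False)]" 1 0] wt[of "[(GC, False), (GA, False), (GA, False)]"]
    by (simp add: e_def defs mult.assoc numeral_2_eq_2)
  have inv': "e (g, False) * e (g, True) = 1" "e (g, True) * e (g, False) = 1" for g
    using inv[of g False] inv[of g True] by simp_all
  consider m where "m > 0" "?a ^ m = 1"
    | m where "m > 0" "let x = ?a ^ m; xi = ?ai ^ m; y = ?b * x * ?bi; yi = ?b * xi * ?bi
      in (x * y * xi * yi) * (xi * y * x * yi) = (xi * y * x * yi) * (x * y * xi * yi)"
    using torsion_or_commuting_commutators[OF _ inv' inv' inv' t ta tb tc] by auto
  then show False
  proof cases
    case 1
    have "\<rho> (replicate m (GA, False)) 0 = \<rho> [] 0"
      using word[OF reduced_replicate] 1 \<rho>_one by (simp add: prod_list_replicate)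
    then have "replicate m (GA, False) = []" by (intro \<rho>_inj reduced_replicate) simp_all
    then show False using 1 by simp
  next
    case 2
    let ?R = "\<lambda>s. replicate m (GA, s)" and ?B = "[(GB, False)]" and ?Bi = "[(GB, True)]"
    \<comment> \<open>The reduced words of \<open>[a^m, y]\<close> for \<open>False\<close> and of
      \<open>[a^(-m), y]\<close> for \<open>True\<close>, where \<open>y\<close> is
      \<open>b a^m b^(-1)\<close>. Nothing cancels when they are concatenated in either
      order.\<close>
    let ?w = "\<lambda>s. ?R s @ ?B @ ?R False @ ?Bi @ ?R (\<not> s) @ ?B @ ?R True @ ?Bi"
    have red: "reduced (?w s @ ?w s')" for s s'
      using 2(1) by (simp add: reduced_replicate_Cons reduced_Cons_replicate)
    have ev: "prod_list (map e (?w False)) = ?a ^ m * (?b * ?a ^ m * ?bi) * ?ai ^ m * (?b * ?ai ^ m * ?bi)"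
      "prod_list (map e (?w True)) = ?ai ^ m * (?b * ?a ^ m * ?bi) * ?a ^ m * (?b * ?ai ^ m * ?bi)"
      by (simp_all add: prod_list_replicate mult.assoc)
    have "\<rho> (?w False @ ?w True) 0 = \<rho> (?w True @ ?w False) 0"
      unfolding word[OF red] map_append[of e "?w False"] map_append[of e "?w True"] prod_list.append ev
      using 2(2) by (simp only: Let_def)
    then have "?w False @ ?w True = ?w True @ ?w False" by (intro \<rho>_inj red)
    \<comment> \<open>One word begins with \<open>a\<close>, the other with its inverse.\<close>
    then have "hd (?w False @ ?w True) = hd (?w True @ ?w False)" by (rule arg_cong)
    then show False using 2(1) by (cases m) simp_all
  qed
qed

end
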